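(* Let $G$ be a finite metacyclic group with metacyclic factorization $G=LK$, $K=\langle a\rangle\trianglelefteq G$, $L=\langle b\rangle$, and let $G=N\rtimes H$ be the Standard Hall decomposition (in the sense of Sim) of this factorization: $N,H$ are Hall subgroups of coprime orders, $N\trianglelefteq G$, $H$ nilpotent, $N=UV$ is a split metacyclic factorization with $U=L\cap N=\langle u\rangle$, $V=K\cap N=\langle v\rangle\trianglelefteq G$, $U$ centralizes $H$, and $G'\cap N=V$. Write $N=\langle u,v\mid v^{\zeta}=u^{\epsilon}=1,\ u^{-1}vu=v^{\eta}\rangle$ and let $\mathcal{F}_N=\{F_0,F_1,\dots,F_\zeta\}$ with $F_0=\langle v\rangle$ and $F_i=\langle uv^{i(\eta-1)}\rangle$ for $1\le i\le\zeta$. For each prime $p$ dividing $|H|$ let $H_p$ be the Sylow $p$-subgroup of $H$, and let $H_p=B_pA_p$ be a metacyclic factorization with $A_p,B_p$ cyclic and $A_p\trianglelefteq H_p$ such that the family $\mathcal{F}_{H_p}$ consisting of $A_p$, $B_p$ and the $H_p$-conjugates of $B_p$ is regular and independent in $H_p$; set $\mathcal{F}_H=\bigcup_p\mathcal{F}_{H_p}$. Let $\mathcal{F}$ be the closure of $\mathcal{F}_N\cup\mathcal{F}_H$ under conjugation by elements of $G$. Then $G$ is the active sum of $\mathcal{F}$.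
   Context: A group is metacyclic if it has a normal cyclic subgroup with cyclic quotient; $G'$ denotes the commutator subgroup. For a group $G$ and a family $\mathcal{F}$ of distinct subgroups that generates $G$ and is closed under conjugation, the active sum $S$ of $\mathcal{F}$ is the free product of the members of $\mathcal{F}$ divided by the normal subgroup generated by all elements $h^{-1}\cdot g\cdot h\cdot (g^h)^{-1}$ with $h\in F_1$, $g\in F_2$, $F_1,F_2\in\mathcal{F}$, where $g^h=h^{-1}gh$ is regarded as an element of the factor $h^{-1}F_2h\in\mathcal{F}$; the inclusions induce a canonical surjection $\varphi:S\to G$, and "$G$ is the active sum of $\mathcal{F}$" means $\varphi$ is an isomorphism. A (discrete) family is regular iff $[F,N_G(F)]=F\cap G'$ for every member $F$, and independent iff for a set $\mathcal{T}$ of representatives of the conjugacy classes of its members the canonical map $\bigoplus_{F\in\mathcal{T}}F/(F\cap G')\to G/G'$ is an isomorphism. In particular, every finite metacyclic group is the active sum of a discrete family of cyclic subgroups. *)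

theory Defs
  imports "HOL-Algebra.Algebra"
begin

definition conj_set :: "('a, 'b) monoid_scheme \<Rightarrow> 'a \<Rightarrow> 'a set \<Rightarrow> 'a set" where
  "conj_set G h F = (\<lambda>f. inv\<^bsub>G\<^esub> h \<otimes>\<^bsub>G\<^esub> f \<otimes>\<^bsub>G\<^esub> h) ` F"

definition comm_sg :: "('a, 'b) monoid_scheme \<Rightarrow> 'a set \<Rightarrow> 'a set \<Rightarrow> 'a set" where
  "comm_sg G A B = generate G (\<Union>x\<in>A. \<Union>y\<in>B.
      {inv\<^bsub>G\<^esub> x \<otimes>\<^bsub>G\<^esub> inv\<^bsub>G\<^esub> y \<otimes>\<^bsub>G\<^esub> x \<otimes>\<^bsub>G\<^esub> y})"

fun lower_central :: "('a, 'b) monoid_scheme \<Rightarrow> nat \<Rightarrow> 'a set" where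
  "lower_central G 0 = carrier G"
| "lower_central G (Suc n) = comm_sg G (lower_central G n) (carrier G)"

definition nilpotent_group :: "('a, 'b) monoid_scheme \<Rightarrow> bool" where
  "nilpotent_group G \<longleftrightarrow> group G \<and> (\<exists>n. lower_central G n = {\<one>\<^bsub>G\<^esub>})"

definition regular_family :: "('a, 'b) monoid_scheme \<Rightarrow> 'a set set \<Rightarrow> bool" where
  "regular_family Q \<F> \<longleftrightarrow>
     (\<forall>F\<in>\<F>. comm_sg Q F (normalizer Q F) = F \<inter> derived Q (carrier Q))"

text \<open>Independent: for a set T of representatives of the Q-conjugacy classes of members,
  the canonical map (direct sum of F/(F \<inter> Q')) to Q/Q' is an isomorphism.
  An element of the direct sum is a family c of cosets c F of F \<inter> Q' in F;
  it is mapped to the product in Q/Q' of the cosets Q' c F.\<close>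
definition independent_family :: "('a, 'b) monoid_scheme \<Rightarrow> 'a set set \<Rightarrow> bool" where
  "independent_family Q \<F> \<longleftrightarrow>
     (\<exists>T. T \<subseteq> \<F> \<and>
        (\<forall>F\<in>\<F>. \<exists>!F'. F' \<in> T \<and> (\<exists>x\<in>carrier Q. F = conj_set Q x F')) \<and>
        (\<lambda>c. finprod (Q Mod (derived Q (carrier Q)))
                (\<lambda>F. derived Q (carrier Q) <#>\<^bsub>Q\<^esub> c F) T)
          \<in> iso (sum_group T (\<lambda>F. subgroup_generated Q F Mod (F \<inter> derived Q (carrier Q))))
                (Q Mod (derived Q (carrier Q))))"

text \<open>Letters are pairs (F, g) with g an element of the factor F.  Words over the
  letters represent elements of the free product of the members of the family.
  The free product, as a monoid, is presented by the relations
  (F,1) = empty word and (F,g)(F,g') = (F,gg'); the active sum is its quotient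
  by the relations h^-1 g h = g^h (h in F1, g in F2, g^h in the factor h^-1 F2 h).
  asum_rel is the monoid congruence generated by all these relations, so the
  active sum S is the set of words modulo asum_rel.\<close>
inductive asum_rel :: "('a, 'b) monoid_scheme \<Rightarrow> 'a set set
      \<Rightarrow> ('a set \<times> 'a) list \<Rightarrow> ('a set \<times> 'a) list \<Rightarrow> bool"
  for G \<F> where
  refl: "asum_rel G \<F> w w"
| sym: "asum_rel G \<F> w1 w2 \<Longrightarrow> asum_rel G \<F> w2 w1"
| trans: "asum_rel G \<F> w1 w2 \<Longrightarrow> asum_rel G \<F> w2 w3 \<Longrightarrow> asum_rel G \<F> w1 w3"
| ctxt: "asum_rel G \<F> w1 w2 \<Longrightarrow> asum_rel G \<F> (u @ w1 @ v) (u @ w2 @ v)"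
| unit: "F \<in> \<F> \<Longrightarrow> asum_rel G \<F> [(F, \<one>\<^bsub>G\<^esub>)] []"
| mult: "F \<in> \<F> \<Longrightarrow> g \<in> F \<Longrightarrow> g' \<in> F \<Longrightarrow>
         asum_rel G \<F> [(F, g), (F, g')] [(F, g \<otimes>\<^bsub>G\<^esub> g')]"
| conj: "F1 \<in> \<F> \<Longrightarrow> F2 \<in> \<F> \<Longrightarrow> h \<in> F1 \<Longrightarrow> g \<in> F2 \<Longrightarrow>
         asum_rel G \<F> [(F1, inv\<^bsub>G\<^esub> h), (F2, g), (F1, h)]
                      [(conj_set G h F2, inv\<^bsub>G\<^esub> h \<otimes>\<^bsub>G\<^esub> g \<otimes>\<^bsub>G\<^esub> h)]"

definition valid_word :: "'a set set \<Rightarrow> ('a set \<times> 'a) list \<Rightarrow> bool" where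
  "valid_word \<F> w \<longleftrightarrow> (\<forall>(F, g) \<in> set w. F \<in> \<F> \<and> g \<in> F)"

text \<open>The canonical map phi from the active sum to G, on representing words.\<close>
definition word_eval :: "('a, 'b) monoid_scheme \<Rightarrow> ('a set \<times> 'a) list \<Rightarrow> 'a" where
  "word_eval G w = foldr (\<lambda>(F, g) acc. g \<otimes>\<^bsub>G\<^esub> acc) w \<one>\<^bsub>G\<^esub>"

text \<open>G is the active sum of the family: the family consists of subgroups, generates G,
  is closed under conjugation, and phi is an isomorphism.  phi is a well defined
  homomorphism, surjective because the family generates G; injectivity says that
  words with the same value in G are equal in the active sum.\<close>
definition is_active_sum :: "('a, 'b) monoid_scheme \<Rightarrow> 'a set set \<Rightarrow> bool" where
  "is_active_sum G \<F> \<longleftrightarrow>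
     (\<forall>F\<in>\<F>. subgroup F G) \<and>
     generate G (\<Union>\<F>) = carrier G \<and>
     (\<forall>F\<in>\<F>. \<forall>x\<in>carrier G. conj_set G x F \<in> \<F>) \<and>
     (\<forall>w1 w2. valid_word \<F> w1 \<longrightarrow> valid_word \<F> w2 \<longrightarrow>
        word_eval G w1 = word_eval G w2 \<longrightarrow> asum_rel G \<F> w1 w2)"

end

(* The active sum S is built as the group of words modulo asum_rel, with the canonical map
   \<phi> : S \<rightarrow> G.  Conjugating a letter (F, g) by any s in S yields the letter
   (F^(\<phi> s), g^(\<phi> s)), so relations between letters can be read off in G.  Hence the copies in S of
   A_p and B_p generate a group isomorphic to H_p: by independence A_p \<inter> B_p lies in H_p',
   by regularity an element g of it is a product of commutators [b, n] with n normalizing B_p,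
   and each such commutator, lifted to S, falls into the copy of A_p.  The copies of the H_p for
   different p commute because H is nilpotent, the copy of U commutes with them, and the copy of
   V is normal in S.  Their product is a subgroup of S mapped bijectively onto G = V U H.  Since
   every member of the family is G-conjugate to V, U, some A_p or some B_p, this subgroup
   contains all letters, so it is S and \<phi> is injective. *)
theory Submission
  imports Defs
begin

section \<open>The active sum as a group\<close>

text \<open>The obstacle is that an element g lying in two members F1 and F2 yields two letters, and
  nothing in the definition of S makes them equal. In the construction this question arises only for
  A_p and B_p, because every other product is taken of subgroups whose images meet trivially. That
  is where regularity and independence enter. All other input from G is of the form "s normalizes or
  centralizes F", and this passes to S through conjugation of letters although injectivity of \<phi>
  is still open. In the family F_N the relation u^-1 v u = v^\<eta> gives v^i u v^-i = u v^(i(\<eta>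
  - 1)), so every F_i with i \<ge> 1 is a conjugate of U. The index i = \<zeta> gives U itself
  because v^\<zeta> = 1. Thus V, U and the A_p, B_p represent all members up to conjugation. Orders
  are counted in G only, since S is not known to be finite beforehand.\<close>

locale conj_closed_family = group G for G :: "('a, 'b) monoid_scheme" (structure) +
  fixes \<F> :: "'a set set"
  assumes member_subgroup: "F \<in> \<F> \<Longrightarrow> subgroup F G"
    and conj_member: "F \<in> \<F> \<Longrightarrow> x \<in> carrier G \<Longrightarrow> conj_set G x F \<in> \<F>"

definition asum_class :: "('a, 'b) monoid_scheme \<Rightarrow> 'a set set \<Rightarrow> ('a set \<times> 'a) list
    \<Rightarrow> ('a set \<times> 'a) list set" where
  "asum_class G \<F> w = {w'. asum_rel G \<F> w w'}"

text \<open>The product is a union over all representatives; it is a single class because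
  \<open>asum_rel\<close> is a congruence. Only classes of valid words are elements, while the
  relation itself lives on all words.\<close>

definition active_sum :: "('a, 'b) monoid_scheme \<Rightarrow> 'a set set
    \<Rightarrow> ('a set \<times> 'a) list set monoid" where
  "active_sum G \<F> = \<lparr>carrier = asum_class G \<F> ` {w. valid_word \<F> w},
     monoid.mult = (\<lambda>A B. \<Union>w1\<in>A. \<Union>w2\<in>B. asum_class G \<F> (w1 @ w2)),
     monoid.one = asum_class G \<F> []\<rparr>"

text \<open>\<open>word_eval\<close> is constant on the class of a valid word, so
  \<open>the_elem\<close> picks the common value.\<close>

definition asum_eval :: "('a, 'b) monoid_scheme \<Rightarrow> ('a set \<times> 'a) list set \<Rightarrow> 'a" where
  "asum_eval G A = the_elem (word_eval G ` A)"

text \<open>The image in S of g taken in the factor F. The factor is part of the data, since the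
  same g in two members may a priori give different elements of S.\<close>

definition letter :: "('a, 'b) monoid_scheme \<Rightarrow> 'a set set \<Rightarrow> 'a set \<Rightarrow> 'a
    \<Rightarrow> ('a set \<times> 'a) list set" where
  "letter G \<F> F g = asum_class G \<F> [(F, g)]"

definition letters :: "('a, 'b) monoid_scheme \<Rightarrow> 'a set set \<Rightarrow> 'a set
    \<Rightarrow> ('a set \<times> 'a) list set set" where
  "letters G \<F> F = letter G \<F> F ` F"

lemma asum_class_eq_iff: "asum_class G \<F> w = asum_class G \<F> w' \<longleftrightarrow> asum_rel G \<F> w w'"
  unfolding asum_class_def by (blast intro: asum_rel.refl asum_rel.sym asum_rel.trans)

lemma asum_rel_append:
  assumes "asum_rel G \<F> w1 w1'" "asum_rel G \<F> w2 w2'"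
  shows "asum_rel G \<F> (w1 @ w2) (w1' @ w2')"
proof -
  have "asum_rel G \<F> (w1 @ w2) (w1' @ w2)"
    using asum_rel.ctxt[OF assms(1), of "[]" w2] by simp
  moreover have "asum_rel G \<F> (w1' @ w2) (w1' @ w2')"
    using asum_rel.ctxt[OF assms(2), of w1' "[]"] by simp
  ultimately show ?thesis by (rule asum_rel.trans)
qed

lemma active_sum_mult:
  "asum_class G \<F> w1 \<otimes>\<^bsub>active_sum G \<F>\<^esub> asum_class G \<F> w2 = asum_class G \<F> (w1 @ w2)"
proof -
  have "asum_class G \<F> (w1' @ w2') = asum_class G \<F> (w1 @ w2)"
    if "w1' \<in> asum_class G \<F> w1" "w2' \<in> asum_class G \<F> w2" for w1' w2'
    using that by (simp add: asum_class_eq_iff) (simp add: asum_class_def asum_rel.sym asum_rel_append)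
  moreover have "w1 \<in> asum_class G \<F> w1" "w2 \<in> asum_class G \<F> w2"
    by (auto simp: asum_class_def asum_rel.refl)
  ultimately have "(\<Union>w1'\<in>asum_class G \<F> w1. \<Union>w2'\<in>asum_class G \<F> w2. asum_class G \<F> (w1' @ w2'))
      = asum_class G \<F> (w1 @ w2)" by blast
  then show ?thesis by (simp add: active_sum_def)
qed

lemma one_active_sum: "\<one>\<^bsub>active_sum G \<F>\<^esub> = asum_class G \<F> []"
  by (simp add: active_sum_def)

lemma carrier_active_sum: "carrier (active_sum G \<F>) = asum_class G \<F> ` {w. valid_word \<F> w}"
  by (simp add: active_sum_def)

lemma valid_word_simps [simp]:
  "valid_word \<F> []"
  "valid_word \<F> ((F, g) # w) \<longleftrightarrow> F \<in> \<F> \<and> g \<in> F \<and> valid_word \<F> w"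
  "valid_word \<F> (w @ w') \<longleftrightarrow> valid_word \<F> w \<and> valid_word \<F> w'"
  by (auto simp: valid_word_def)

lemma word_eval_simps [simp]:
  "word_eval G [] = \<one>\<^bsub>G\<^esub>"
  "word_eval G ((F, g) # w) = g \<otimes>\<^bsub>G\<^esub> word_eval G w"
  by (auto simp: word_eval_def)

lemma conj_setI: "g \<in> F \<Longrightarrow> inv\<^bsub>G\<^esub> h \<otimes>\<^bsub>G\<^esub> g \<otimes>\<^bsub>G\<^esub> h \<in> conj_set G h F"
  by (auto simp: conj_set_def)

section \<open>Conjugates of subsets and subgroups\<close>

context group
begin

lemma conj_set_conj_set:
  assumes "F \<subseteq> carrier G" "x \<in> carrier G" "y \<in> carrier G"
  shows "conj_set G y (conj_set G x F) = conj_set G (x \<otimes> y) F"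
proof -
  have "inv y \<otimes> (inv x \<otimes> f \<otimes> x) \<otimes> y = inv (x \<otimes> y) \<otimes> f \<otimes> (x \<otimes> y)" if "f \<in> F" for f
    using that assms by (auto simp: inv_mult_group m_assoc subset_iff)
  then show ?thesis by (auto simp: conj_set_def image_image)
qed

lemma conj_set_one:
  assumes "F \<subseteq> carrier G"
  shows "conj_set G \<one> F = F"
proof -
  have "inv \<one> \<otimes> f \<otimes> \<one> = f" if "f \<in> F" for f using that assms by auto
  then show ?thesis by (simp add: conj_set_def)
qed

lemma conj_subset:
  assumes "F \<subseteq> carrier G" "x \<in> carrier G"
  shows "conj_set G x F \<subseteq> carrier G"
  using assms by (auto simp: conj_set_def)

lemma conj_mult:
  assumes "x \<in> carrier G" "g \<in> carrier G" "h \<in> carrier G"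
  shows "inv x \<otimes> (g \<otimes> h) \<otimes> x = (inv x \<otimes> g \<otimes> x) \<otimes> (inv x \<otimes> h \<otimes> x)"
proof -
  have "x \<otimes> (inv x \<otimes> (h \<otimes> x)) = h \<otimes> x"
    using assms by (simp flip: m_assoc)
  then show ?thesis using assms by (simp add: m_assoc)
qed

lemma conj_hom: "x \<in> carrier G \<Longrightarrow> (\<lambda>g. inv x \<otimes> g \<otimes> x) \<in> hom G G"
  by (rule homI) (auto simp: conj_mult)

lemma subgroup_conj_set:
  assumes "subgroup F G" "x \<in> carrier G"
  shows "subgroup (conj_set G x F) G"
proof -
  interpret h: group_hom G G "\<lambda>g. inv x \<otimes> g \<otimes> x"
    by unfold_locales (rule conj_hom[OF assms(2)])
  show ?thesis unfolding conj_set_def by (rule h.subgroup_img_is_subgroup[OF assms(1)])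
qed

lemma conj_set_generate:
  assumes "g \<in> carrier G" "x \<in> carrier G"
  shows "conj_set G x (generate G {g}) = generate G {inv x \<otimes> g \<otimes> x}"
proof -
  interpret h: group_hom G G "\<lambda>g. inv x \<otimes> g \<otimes> x"
    by unfold_locales (rule conj_hom[OF assms(2)])
  show ?thesis using h.generate_img[of "{g}"] assms(1) by (simp add: conj_set_def)
qed

end

section \<open>Group structure of the active sum and conjugation of letters\<close>

context conj_closed_family
begin

abbreviation "S \<equiv> active_sum G \<F>"
abbreviation "\<phi> \<equiv> asum_eval G"

lemma member_subset: "F \<in> \<F> \<Longrightarrow> g \<in> F \<Longrightarrow> g \<in> carrier G"
  using member_subgroup subgroup.mem_carrier by metis

lemma word_eval_closed: "valid_word \<F> w \<Longrightarrow> word_eval G w \<in> carrier G"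
  by (induction w) (auto simp: member_subset)

lemma word_eval_append:
  "valid_word \<F> w \<Longrightarrow> valid_word \<F> w' \<Longrightarrow> word_eval G (w @ w') = word_eval G w \<otimes> word_eval G w'"
  by (induction w) (auto simp: member_subset word_eval_closed m_assoc)

text \<open>Each defining relation preserves values, so \<phi> is well defined. As
  \<open>asum_rel\<close> relates arbitrary words, validity is carried along in both directions; the
  case of symmetry depends on the equivalence.\<close>

lemma asum_rel_invariant:
  "asum_rel G \<F> w1 w2 \<Longrightarrow>
    (valid_word \<F> w1 \<longleftrightarrow> valid_word \<F> w2) \<and> (valid_word \<F> w1 \<longrightarrow> word_eval G w1 = word_eval G w2)"
proof (induction rule: asum_rel.induct)
  case (ctxt w1 w2 u v)
  then show ?case by (auto simp: word_eval_append)
next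
  case (unit F)
  then show ?case using member_subgroup subgroup.one_closed by fastforce
next
  case (mult F g g')
  then have "g \<otimes> g' \<in> F" using member_subgroup subgroup.m_closed by metis
  with mult show ?case by (auto simp: member_subset m_assoc)
next
  case (conj F1 F2 h g)
  then have "inv h \<in> F1" using member_subgroup subgroup.m_inv_closed by metis
  with conj show ?case
    using conj_setI[of g F2 G h] by (auto simp: member_subset m_assoc conj_member)
qed auto

lemma asum_eval_class:
  assumes "valid_word \<F> w"
  shows "\<phi> (asum_class G \<F> w) = word_eval G w"
proof -
  have "word_eval G w' = word_eval G w" if "w' \<in> asum_class G \<F> w" for w'
    using asum_rel_invariant[of w w'] assms that by (simp add: asum_class_def)
  moreover have "w \<in> asum_class G \<F> w" by (simp add: asum_class_def asum_rel.refl)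
  ultimately have "word_eval G ` asum_class G \<F> w = {word_eval G w}" by blast
  then show ?thesis by (simp add: asum_eval_def)
qed

lemma letter_closed: "F \<in> \<F> \<Longrightarrow> g \<in> F \<Longrightarrow> letter G \<F> F g \<in> carrier S"
  by (simp add: letter_def carrier_active_sum)

lemma letter_mult:
  "F \<in> \<F> \<Longrightarrow> g \<in> F \<Longrightarrow> h \<in> F \<Longrightarrow> letter G \<F> F (g \<otimes> h) = letter G \<F> F g \<otimes>\<^bsub>S\<^esub> letter G \<F> F h"
  unfolding letter_def active_sum_mult asum_class_eq_iff
  using asum_rel.sym[OF asum_rel.mult] by simp

lemma letter_one: "F \<in> \<F> \<Longrightarrow> letter G \<F> F \<one> = \<one>\<^bsub>S\<^esub>"
  unfolding letter_def one_active_sum asum_class_eq_iff by (rule asum_rel.unit)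

lemma word_induct [consumes 1, case_names one letter]:
  assumes "s \<in> carrier S"
    and "P \<one>\<^bsub>S\<^esub>"
    and "\<And>F g t. F \<in> \<F> \<Longrightarrow> g \<in> F \<Longrightarrow> t \<in> carrier S \<Longrightarrow> P t \<Longrightarrow> P (letter G \<F> F g \<otimes>\<^bsub>S\<^esub> t)"
  shows "P s"
proof -
  have "P (asum_class G \<F> w)" if "valid_word \<F> w" for w
    using that
  proof (induction w)
    case Nil
    then show ?case using assms(2) by (simp add: one_active_sum)
  next
    case (Cons p w)
    obtain F g where p: "p = (F, g)" by (cases p)
    have "P (letter G \<F> F g \<otimes>\<^bsub>S\<^esub> asum_class G \<F> w)"
      using Cons p by (intro assms(3)) (auto simp: carrier_active_sum)
    then show ?case by (simp add: letter_def active_sum_mult p)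
  qed
  then show ?thesis using assms(1) by (auto simp: carrier_active_sum)
qed

sublocale S: group S
proof (rule groupI)
  fix x y assume "x \<in> carrier S" "y \<in> carrier S"
  then show "x \<otimes>\<^bsub>S\<^esub> y \<in> carrier S"
    by (auto simp: carrier_active_sum active_sum_mult intro!: imageI)
next
  show "\<one>\<^bsub>S\<^esub> \<in> carrier S" by (simp add: carrier_active_sum one_active_sum)
next
  fix x y z assume "x \<in> carrier S" "y \<in> carrier S" "z \<in> carrier S"
  then show "x \<otimes>\<^bsub>S\<^esub> y \<otimes>\<^bsub>S\<^esub> z = x \<otimes>\<^bsub>S\<^esub> (y \<otimes>\<^bsub>S\<^esub> z)"
    by (auto simp: carrier_active_sum active_sum_mult)
next
  fix x assume "x \<in> carrier S"
  then show "\<one>\<^bsub>S\<^esub> \<otimes>\<^bsub>S\<^esub> x = x"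
    by (auto simp: carrier_active_sum active_sum_mult one_active_sum)
next
  fix x assume "x \<in> carrier S"
  then obtain w where "valid_word \<F> w" "x = asum_class G \<F> w" by (auto simp: carrier_active_sum)
  \<comment> \<open>The inverse is built letter by letter: \<open>inv g\<close> is appended to the
    inverse word of the tail, meets g, and the pair cancels by \<open>mult\<close> and
    \<open>unit\<close>.\<close>
  moreover have "\<exists>w'. valid_word \<F> w' \<and> asum_rel G \<F> (w' @ w) []" if "valid_word \<F> w" for w
    using that
  proof (induction w)
    case Nil
    then show ?case using asum_rel.refl by (intro exI[of _ "[]"]) simp
  next
    case (Cons p w)
    obtain F g where p: "p = (F, g)" by (cases p)
    have F: "F \<in> \<F>" "g \<in> F" "valid_word \<F> w" using Cons.prems p by auto
    obtain w' where w': "valid_word \<F> w'" "asum_rel G \<F> (w' @ w) []" using Cons.IH F by blast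
    have i: "inv g \<in> F" using F member_subgroup subgroup.m_inv_closed by metis
    have "asum_rel G \<F> [(F, inv g), (F, g)] [(F, inv g \<otimes> g)]" by (rule asum_rel.mult) fact+
    moreover have "asum_rel G \<F> [(F, inv g \<otimes> g)] []"
      using asum_rel.unit[of F \<F> G] F by (simp add: member_subset)
    ultimately have "asum_rel G \<F> [(F, inv g), (F, g)] []" by (rule asum_rel.trans)
    then have "asum_rel G \<F> (w' @ [(F, inv g), (F, g)] @ w) (w' @ [] @ w)" by (rule asum_rel.ctxt)
    with w' have "asum_rel G \<F> ((w' @ [(F, inv g)]) @ p # w) []" by (auto simp: p intro: asum_rel.trans)
    then show ?case using w' F i by (intro exI[of _ "w' @ [(F, inv g)]"]) simp
  qed
  ultimately obtain w' where "valid_word \<F> w'" "asum_rel G \<F> (w' @ w) []" by blast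
  then show "\<exists>y\<in>carrier S. y \<otimes>\<^bsub>S\<^esub> x = \<one>\<^bsub>S\<^esub>"
    using \<open>x = _\<close>
    by (intro bexI[of _ "asum_class G \<F> w'"])
       (auto simp: carrier_active_sum active_sum_mult one_active_sum asum_class_eq_iff)
qed

sublocale \<phi>: group_hom S G \<phi>
proof unfold_locales
  show "\<phi> \<in> hom S G"
    by (rule homI)
       (auto simp: carrier_active_sum active_sum_mult asum_eval_class word_eval_closed word_eval_append)
qed

lemma eval_letter: "F \<in> \<F> \<Longrightarrow> g \<in> F \<Longrightarrow> \<phi> (letter G \<F> F g) = g"
  by (simp add: letter_def asum_eval_class member_subset)

lemma letter_inv:
  assumes "F \<in> \<F>" "g \<in> F"
  shows "letter G \<F> F (inv g) = inv\<^bsub>S\<^esub> letter G \<F> F g"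
proof (rule S.inv_equality[symmetric])
  have i: "inv g \<in> F" using assms member_subgroup subgroup.m_inv_closed by metis
  show "letter G \<F> F (inv g) \<otimes>\<^bsub>S\<^esub> letter G \<F> F g = \<one>\<^bsub>S\<^esub>"
    using assms i by (simp flip: letter_mult add: member_subset letter_one)
  show "letter G \<F> F (inv g) \<in> carrier S" "letter G \<F> F g \<in> carrier S"
    using assms i by (auto intro: letter_closed)
qed

text \<open>For s a single letter this is the relation \<open>conj\<close>. A product of letters
  conjugates in succession, and closure of the family under conjugation keeps every intermediate
  factor a member. Only the value of s in G appears on the right.\<close>

lemma letter_conj:
  assumes "s \<in> carrier S" "F \<in> \<F>" "g \<in> F"
  shows "inv\<^bsub>S\<^esub> s \<otimes>\<^bsub>S\<^esub> letter G \<F> F g \<otimes>\<^bsub>S\<^esub> s =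
    letter G \<F> (conj_set G (\<phi> s) F) (inv (\<phi> s) \<otimes> g \<otimes> \<phi> s)"
  using assms
proof (induction s arbitrary: F g rule: word_induct)
  case one
  then show ?case
    using subgroup.subset[OF member_subgroup]
    by (simp add: letter_closed conj_set_one member_subset)
next
  case (letter F' h t)
  have c [simp]: "h \<in> carrier G" "g \<in> carrier G" "\<phi> t \<in> carrier G" "letter G \<F> F' h \<in> carrier S"
      "letter G \<F> F g \<in> carrier S" "F \<subseteq> carrier G"
    using letter by (auto simp: member_subset letter_closed)
  have "inv\<^bsub>S\<^esub> letter G \<F> F' h \<otimes>\<^bsub>S\<^esub> letter G \<F> F g \<otimes>\<^bsub>S\<^esub> letter G \<F> F' h
      = letter G \<F> (conj_set G h F) (inv h \<otimes> g \<otimes> h)"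
    using asum_rel.conj[of F' \<F> F h g G] letter
    by (simp flip: letter_inv) (simp add: letter_def active_sum_mult asum_class_eq_iff)
  moreover have "inv\<^bsub>S\<^esub> (letter G \<F> F' h \<otimes>\<^bsub>S\<^esub> t) \<otimes>\<^bsub>S\<^esub> letter G \<F> F g \<otimes>\<^bsub>S\<^esub> (letter G \<F> F' h \<otimes>\<^bsub>S\<^esub> t)
      = inv\<^bsub>S\<^esub> t \<otimes>\<^bsub>S\<^esub> (inv\<^bsub>S\<^esub> letter G \<F> F' h \<otimes>\<^bsub>S\<^esub> letter G \<F> F g \<otimes>\<^bsub>S\<^esub> letter G \<F> F' h) \<otimes>\<^bsub>S\<^esub> t"
    using letter.hyps by (simp add: S.inv_mult_group S.m_assoc)
  ultimately have "inv\<^bsub>S\<^esub> (letter G \<F> F' h \<otimes>\<^bsub>S\<^esub> t) \<otimes>\<^bsub>S\<^esub> letter G \<F> F g \<otimes>\<^bsub>S\<^esub> (letter G \<F> F' h \<otimes>\<^bsub>S\<^esub> t)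
      = letter G \<F> (conj_set G (\<phi> t) (conj_set G h F)) (inv \<phi> t \<otimes> (inv h \<otimes> g \<otimes> h) \<otimes> \<phi> t)"
    using letter by (simp add: conj_member conj_setI)
  then show ?case
    using letter by (simp add: conj_set_conj_set eval_letter inv_mult_group m_assoc)
qed

lemma letters_subgroup: "F \<in> \<F> \<Longrightarrow> subgroup (letters G \<F> F) S"
proof (rule S.subgroupI)
  assume F: "F \<in> \<F>"
  interpret F: subgroup F G by (rule member_subgroup[OF F])
  show "letters G \<F> F \<subseteq> carrier S" using F by (auto simp: letters_def letter_closed)
  show "letters G \<F> F \<noteq> {}" using F.one_closed by (metis letters_def image_is_empty empty_iff)
  fix x assume "x \<in> letters G \<F> F"
  then obtain g where g: "g \<in> F" "x = letter G \<F> F g" by (auto simp: letters_def)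
  show "inv\<^bsub>S\<^esub> x \<in> letters G \<F> F"
    using F g by (simp add: letters_def flip: letter_inv)
  fix y assume "y \<in> letters G \<F> F"
  then obtain h where "h \<in> F" "y = letter G \<F> F h" by (auto simp: letters_def)
  then show "x \<otimes>\<^bsub>S\<^esub> y \<in> letters G \<F> F"
    using F g by (simp add: letters_def flip: letter_mult)
qed

lemma letters_inj: "F \<in> \<F> \<Longrightarrow> inj_on \<phi> (letters G \<F> F)"
  by (rule inj_onI) (auto simp: letters_def eval_letter)

lemma eval_letters: "F \<in> \<F> \<Longrightarrow> \<phi> ` letters G \<F> F = F"
  by (simp add: letters_def image_image eval_letter)

lemma letters_conj:
  assumes "s \<in> carrier S" "F \<in> \<F>" "d \<in> letters G \<F> F"
  shows "inv\<^bsub>S\<^esub> s \<otimes>\<^bsub>S\<^esub> d \<otimes>\<^bsub>S\<^esub> s \<in> letters G \<F> (conj_set G (\<phi> s) F)"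
proof -
  obtain g where "g \<in> F" "d = letter G \<F> F g" using assms by (auto simp: letters_def)
  then show ?thesis using assms by (simp add: letter_conj letters_def conj_setI)
qed

text \<open>Conjugation by s acts on a letter through \<phi> s. If \<phi> s centralizes F, it fixes
  both the label F and the element g, so commutation in G lifts to S.\<close>

lemma letters_commute:
  assumes "s \<in> carrier S" "F \<in> \<F>" "d \<in> letters G \<F> F"
    and cent: "\<And>g. g \<in> F \<Longrightarrow> g \<otimes> \<phi> s = \<phi> s \<otimes> g"
  shows "d \<otimes>\<^bsub>S\<^esub> s = s \<otimes>\<^bsub>S\<^esub> d"
proof -
  obtain g where g: "g \<in> F" "d = letter G \<F> F g" using assms by (auto simp: letters_def)
  have c: "\<phi> s \<in> carrier G" "d \<in> carrier S" using assms g by (auto simp: letter_closed)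
  have fix_g: "inv \<phi> s \<otimes> g' \<otimes> \<phi> s = g'" if "g' \<in> F" for g'
  proof -
    have "g' \<in> carrier G" using that assms by (auto simp: member_subset)
    then show ?thesis using c cent[OF that] by (simp add: m_assoc inv_solve_left')
  qed
  have "conj_set G (\<phi> s) F = F" unfolding conj_set_def by (simp add: fix_g)
  then have "inv\<^bsub>S\<^esub> s \<otimes>\<^bsub>S\<^esub> d \<otimes>\<^bsub>S\<^esub> s = d"
    using letter_conj[of s F g] assms g fix_g by simp
  then have "s \<otimes>\<^bsub>S\<^esub> (inv\<^bsub>S\<^esub> s \<otimes>\<^bsub>S\<^esub> d \<otimes>\<^bsub>S\<^esub> s) = s \<otimes>\<^bsub>S\<^esub> d" by simp
  then show ?thesis using c assms(1) by (simp flip: S.m_assoc)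
qed

end

section \<open>Products of subgroups and coprime elements of nilpotent groups\<close>

context group
begin

text \<open>As E is closed under inverses, conjugation in one direction suffices: d e d' e' is
  rewritten as d (e d' e^-1) e e'.\<close>

lemma subgroup_set_mult:
  assumes D: "subgroup D G" and E: "subgroup E G"
    and norm: "\<And>d e. d \<in> D \<Longrightarrow> e \<in> E \<Longrightarrow> inv e \<otimes> d \<otimes> e \<in> D"
  shows "subgroup (D <#> E) G"
proof (rule subgroupI)
  interpret D: subgroup D G by fact
  interpret E: subgroup E G by fact
  show "D <#> E \<subseteq> carrier G" by (auto simp: set_mult_def)
  show "D <#> E \<noteq> {}" using D.one_closed E.one_closed unfolding set_mult_def by blast
  fix x assume "x \<in> D <#> E"
  then obtain d e where x: "d \<in> D" "e \<in> E" "x = d \<otimes> e" by (auto simp: set_mult_def)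
  have "inv x = (inv e \<otimes> inv d \<otimes> e) \<otimes> inv e"
    using x by (simp add: inv_mult_group m_assoc)
  moreover have "inv e \<otimes> inv d \<otimes> e \<in> D" using norm x by simp
  ultimately show "inv x \<in> D <#> E" using x E.m_inv_closed by (auto simp: set_mult_def)
  fix y assume "y \<in> D <#> E"
  then obtain d' e' where y: "d' \<in> D" "e' \<in> E" "y = d' \<otimes> e'" by (auto simp: set_mult_def)
  have "x \<otimes> y = (d \<otimes> (inv (inv e) \<otimes> d' \<otimes> inv e)) \<otimes> (e \<otimes> e')"
  proof -
    have "inv e \<otimes> (e \<otimes> e') = e'" using x y by (simp flip: m_assoc)
    then show ?thesis using x y by (simp add: m_assoc)
  qed
  moreover have "d \<otimes> (inv (inv e) \<otimes> d' \<otimes> inv e) \<in> D"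
    using norm[of d' "inv e"] x y by simp
  moreover have "e \<otimes> e' \<in> E" using x y by simp
  ultimately show "x \<otimes> y \<in> D <#> E" unfolding set_mult_def by blast
qed

lemma set_mult_subset_left:
  assumes "D \<subseteq> carrier G" "subgroup E G"
  shows "D \<subseteq> D <#> E"
  using assms(1) r_one subgroup.one_closed[OF assms(2)] unfolding set_mult_def by fastforce

lemma set_mult_subset_right:
  assumes "subgroup D G" "E \<subseteq> carrier G"
  shows "E \<subseteq> D <#> E"
  using assms(2) l_one subgroup.one_closed[OF assms(1)] unfolding set_mult_def by fastforce

lemma commute_conj:
  assumes "x \<in> carrier G" "y \<in> carrier G" "x \<otimes> y = y \<otimes> x"
  shows "inv y \<otimes> x \<otimes> y = x"
  using assms by (simp add: m_assoc inv_solve_left')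

lemma card_set_mult_trivial_Int:
  assumes D: "subgroup D G" and E: "subgroup E G" and DE: "D \<inter> E = {\<one>}"
  shows "card (D <#> E) = card D * card E"
proof -
  interpret D: subgroup D G by fact
  interpret E: subgroup E G by fact
  have "inj_on (\<lambda>(d, e). d \<otimes> e) (D \<times> E)"
  proof (rule inj_onI, clarify)
    fix d e d' e' assume A: "d \<in> D" "e \<in> E" "d' \<in> D" "e' \<in> E" "d \<otimes> e = d' \<otimes> e'"
    have "inv d' \<otimes> d = e' \<otimes> inv e"
    proof -
      have "inv d' \<otimes> (d \<otimes> e) \<otimes> inv e = inv d' \<otimes> (d' \<otimes> e') \<otimes> inv e" using A by simp
      then have "inv d' \<otimes> d \<otimes> (e \<otimes> inv e) = (inv d' \<otimes> d') \<otimes> e' \<otimes> inv e"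
        using A(1-4) by (simp only: m_assoc D.mem_carrier E.mem_carrier m_closed inv_closed)
      then show ?thesis using A(1-4) by simp
    qed
    moreover have "inv d' \<otimes> d \<in> D" "e' \<otimes> inv e \<in> E" using A by auto
    ultimately have *: "inv d' \<otimes> d = \<one>" "e' \<otimes> inv e = \<one>" using DE by auto
    have "d = d'" using inv_equality[OF *(1)] A(1,3) by (metis inv_inv D.mem_carrier inv_closed)
    moreover have "e = e'" using inv_equality[OF *(2)] A by simp
    ultimately show "d = d' \<and> e = e'" ..
  qed
  moreover have "D <#> E = (\<lambda>(d, e). d \<otimes> e) ` (D \<times> E)" by (auto simp: set_mult_def)
  ultimately show ?thesis by (simp add: card_image card_cartesian_product)
qed

lemma card_subgroup_dvd:
  assumes "subgroup D G" "subgroup E G" "D \<subseteq> E"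
  shows "card D dvd card E"
proof -
  interpret E: subgroup E G by fact
  interpret Q: group "subgroup_generated G E" by simp
  have "subgroup D (subgroup_generated G E)"
    using assms by (simp add: subgroup_of_subgroup_generated)
  from Q.lagrange[OF this] show ?thesis by (metis order_def E.carrier_subgroup_generated_subgroup dvd_triv_right)
qed

section \<open>Coprime orders and commutation in nilpotent groups\<close>

lemma pow_card_subgroup:
  assumes "subgroup D G" "x \<in> D" "finite D"
  shows "x [^] card D = \<one>"
proof -
  interpret D: subgroup D G by fact
  interpret Q: group "subgroup_generated G D" by simp
  have "x [^]\<^bsub>subgroup_generated G D\<^esub> order (subgroup_generated G D) = \<one>\<^bsub>subgroup_generated G D\<^esub>"
    using assms by (intro Q.pow_order_eq_1) auto
  then show ?thesis by (simp add: order_def pow_subgroup_generated)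
qed

lemma eq_one_of_coprime_pow:
  assumes "x \<in> carrier G" "x [^] (m::nat) = \<one>" "x [^] n = \<one>" "coprime m n"
  shows "x = \<one>"
  by (metis assms coprime_common_divisor_nat is_unit_gcd One_nat_def coprime_def nat_dvd_1_iff_1 ord_eq_1 pow_eq_id)

lemma coprime_card_Int:
  assumes "subgroup D G" "subgroup E G" "finite D" "finite E" "coprime (card D) (card E)"
  shows "D \<inter> E = {\<one>}"
proof -
  have "x = \<one>" if "x \<in> D" "x \<in> E" for x
    using eq_one_of_coprime_pow[of x "card D" "card E"] assms that pow_card_subgroup
      subgroup.mem_carrier by metis
  then show ?thesis using assms(1,2) subgroup.one_closed by blast
qed

text \<open>The element x c = y^-1 x y is a conjugate of x, so its m-th power is 1; since c commutes
  with x, this power is x^m c^m, whence c^m = 1. Likewise c y^-1 = x^-1 y^-1 x gives c^n = 1, and m,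
  n are coprime.\<close>

lemma central_commutator_trivial:
  assumes x: "x \<in> carrier G" "x [^] (m::nat) = \<one>" and y: "y \<in> carrier G" "y [^] n = \<one>"
    and mn: "coprime m n"
    and c: "c = inv x \<otimes> inv y \<otimes> x \<otimes> y" "c \<otimes> x = x \<otimes> c" "c \<otimes> y = y \<otimes> c"
  shows "c = \<one>"
proof (rule eq_one_of_coprime_pow[OF _ _ _ mn])
  show cc: "c \<in> carrier G" using x y c by simp
  have xc: "x \<otimes> c = inv y \<otimes> x \<otimes> y"
    unfolding c(1) using x(1) y(1) by (simp add: m_assoc flip: m_assoc[of x "inv x"])
  have "(inv y \<otimes> x \<otimes> y) [^] k = inv y \<otimes> x [^] k \<otimes> y" for k :: nat
    using x y by (induction k) (simp_all add: conj_mult)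
  then have "(x \<otimes> c) [^] m = \<one>" using xc x y by simp
  moreover have "(x \<otimes> c) [^] m = x [^] m \<otimes> c [^] m"
    using pow_mult_distrib[of x c] c(2) x cc by simp
  ultimately show "c [^] m = \<one>" using x cc by simp
  have cy: "c \<otimes> inv y = inv x \<otimes> inv y \<otimes> x"
    unfolding c(1) using x(1) y(1) by (simp add: m_assoc)
  have "(inv x \<otimes> inv y \<otimes> x) [^] k = inv x \<otimes> (inv y) [^] k \<otimes> x" for k :: nat
    using x y by (induction k) (simp_all add: conj_mult)
  moreover have iy: "inv y [^] n = \<one>" using y by (simp add: nat_pow_inv)
  ultimately have "(c \<otimes> inv y) [^] n = \<one>" using cy x y by simp
  moreover have "c \<otimes> inv y = inv y \<otimes> c"
    using commute_conj[OF cc y(1) c(3)] cc y(1) by (metis inv_closed inv_solve_right' m_closed)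
  then have "(c \<otimes> inv y) [^] n = c [^] n \<otimes> inv y [^] n"
    using pow_mult_distrib[of c "inv y"] y cc by simp
  ultimately show "c [^] n = \<one>" using iy cc by simp
qed

lemma lower_central_normal: "lower_central G n \<lhd> G"
proof (induction n)
  case 0
  then show ?case by (simp add: normal_self)
next
  case (Suc n)
  interpret N: normal "lower_central G n" G by fact
  show ?case
    unfolding lower_central.simps comm_sg_def
  proof (rule normal_generateI)
    fix h g
    assume "h \<in> (\<Union>x\<in>lower_central G n. \<Union>y\<in>carrier G. {inv x \<otimes> inv y \<otimes> x \<otimes> y})" and g: "g \<in> carrier G"
    then obtain x y where xy: "x \<in> lower_central G n" "y \<in> carrier G" "h = inv x \<otimes> inv y \<otimes> x \<otimes> y"
      by auto
    \<comment> \<open>\<open>normal_generateI\<close> conjugates as g h g^-1, the conjugation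
      homomorphism as k^-1 h k. A conjugate of a commutator is the commutator of the
      conjugates.\<close>
    define k where "k = inv g"
    have k: "k \<in> carrier G" "g = inv k" using g by (auto simp: k_def)
    have xc: "x \<in> carrier G" using xy by auto
    have i: "inv (inv k \<otimes> z \<otimes> k) = inv k \<otimes> inv z \<otimes> k" if "z \<in> carrier G" for z
      using that k by (simp add: inv_mult_group m_assoc)
    have "g \<otimes> h \<otimes> inv g = inv (inv k \<otimes> x \<otimes> k) \<otimes> inv (inv k \<otimes> y \<otimes> k) \<otimes> (inv k \<otimes> x \<otimes> k) \<otimes> (inv k \<otimes> y \<otimes> k)"
      using xc xy(2) k by (simp add: xy(3) conj_mult i)
    moreover have "inv k \<otimes> x \<otimes> k \<in> lower_central G n" using N.inv_op_closed1 k xy by simp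
    moreover have "inv k \<otimes> y \<otimes> k \<in> carrier G" using xy k by simp
    ultimately show "g \<otimes> h \<otimes> inv g \<in> (\<Union>x\<in>lower_central G n. \<Union>y\<in>carrier G. {inv x \<otimes> inv y \<otimes> x \<otimes> y})"
      by blast
  qed auto
qed

text \<open>The commutator c of x and y descends the lower central series: if c lies in the k-th
  term, its commutators with G lie in the next one, so modulo that term c commutes with everything
  and \<open>central_commutator_trivial\<close> kills it there. By nilpotency the series reaches
  1.\<close>

lemma nilpotent_coprime_commute:
  assumes nil: "nilpotent_group G"
    and x: "x \<in> carrier G" "x [^] (m::nat) = \<one>" and y: "y \<in> carrier G" "y [^] n = \<one>"
    and mn: "coprime m n"
  shows "x \<otimes> y = y \<otimes> x"
proof -
  define c where "c = inv x \<otimes> inv y \<otimes> x \<otimes> y"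
  have cc: "c \<in> carrier G" using x y by (simp add: c_def)
  have "c \<in> lower_central G k" for k
  proof (induction k)
    case 0
    then show ?case using cc by simp
  next
    case (Suc k)
    let ?N = "lower_central G (Suc k)"
    interpret N: normal ?N G by (rule lower_central_normal)
    interpret Q: group "G Mod ?N" by (rule N.factorgroup_is_group)
    interpret \<pi>: group_hom G "G Mod ?N" "\<lambda>a. ?N #> a"
      by unfold_locales (rule N.r_coset_hom_Mod)
    have comm: "(?N #> c) \<otimes>\<^bsub>G Mod ?N\<^esub> (?N #> z) = (?N #> z) \<otimes>\<^bsub>G Mod ?N\<^esub> (?N #> c)"
      if z: "z \<in> carrier G" for z
    proof -
      have "inv c \<otimes> inv z \<otimes> c \<otimes> z \<in> ?N"
        using Suc z unfolding lower_central.simps comm_sg_def by (intro generate.incl) auto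
      then have "?N #> (inv c \<otimes> inv z \<otimes> c \<otimes> z) = \<one>\<^bsub>G Mod ?N\<^esub>"
        by (simp add: FactGroup_def N.rcos_const del: lower_central.simps)
      moreover have "c \<otimes> z = (z \<otimes> c) \<otimes> (inv c \<otimes> inv z \<otimes> c \<otimes> z)"
        using cc z by (simp add: m_assoc flip: m_assoc[of c "inv c"] m_assoc[of z "inv z"])
      ultimately have "?N #> (c \<otimes> z) = (?N #> (z \<otimes> c)) \<otimes>\<^bsub>G Mod ?N\<^esub> \<one>\<^bsub>G Mod ?N\<^esub>"
        using cc z by (metis \<pi>.hom_mult inv_closed m_closed)
      then have "?N #> (c \<otimes> z) = ?N #> (z \<otimes> c)"
        using cc z by (metis Q.r_one \<pi>.hom_closed m_closed)
      then show ?thesis using cc z by (metis \<pi>.hom_mult)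
    qed
    have "?N #> c = \<one>\<^bsub>G Mod ?N\<^esub>"
    proof (rule Q.central_commutator_trivial[OF _ _ _ _ mn])
      show "(?N #> x) [^]\<^bsub>G Mod ?N\<^esub> m = \<one>\<^bsub>G Mod ?N\<^esub>" "(?N #> y) [^]\<^bsub>G Mod ?N\<^esub> n = \<one>\<^bsub>G Mod ?N\<^esub>"
        using x y by (metis \<pi>.hom_nat_pow \<pi>.hom_one)+
      show "?N #> c = inv\<^bsub>G Mod ?N\<^esub> (?N #> x) \<otimes>\<^bsub>G Mod ?N\<^esub> inv\<^bsub>G Mod ?N\<^esub> (?N #> y) \<otimes>\<^bsub>G Mod ?N\<^esub>
          (?N #> x) \<otimes>\<^bsub>G Mod ?N\<^esub> (?N #> y)"
        unfolding c_def using x(1) y(1) by (metis \<pi>.hom_mult \<pi>.hom_inv inv_closed m_closed)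
      show "?N #> x \<in> carrier (G Mod ?N)" "?N #> y \<in> carrier (G Mod ?N)"
        by (rule \<pi>.hom_closed, fact)+
    qed (rule comm[OF x(1)] comm[OF y(1)])+
    then have "?N #> c = ?N" by (simp add: FactGroup_def)
    then show ?case using rcos_self[OF cc N.subgroup_axioms] by simp
  qed
  then have "c = \<one>" using nil by (auto simp: nilpotent_group_def)
  then have "(y \<otimes> x) \<otimes> c = y \<otimes> x" using x y by simp
  moreover have "(y \<otimes> x) \<otimes> c = x \<otimes> y"
    using x y by (simp add: c_def m_assoc flip: m_assoc[of x "inv x"] m_assoc[of y "inv y"])
  ultimately show ?thesis by simp
qed

lemma conj_set_subgroup_generated:
  assumes "x \<in> carrier (subgroup_generated G M)"
  shows "conj_set (subgroup_generated G M) x F = conj_set G x F"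
  using assms by (simp add: conj_set_def)

lemma conj_set_eq_self:
  assumes "\<And>g. g \<in> F \<Longrightarrow> inv x \<otimes> g \<otimes> x \<in> F" "\<And>g. g \<in> F \<Longrightarrow> x \<otimes> g \<otimes> inv x \<in> F"
    and "F \<subseteq> carrier G" "x \<in> carrier G"
  shows "conj_set G x F = F"
proof
  show "conj_set G x F \<subseteq> F" using assms(1) by (auto simp: conj_set_def)
  show "F \<subseteq> conj_set G x F"
  proof
    fix g assume g: "g \<in> F"
    have "inv x \<otimes> (x \<otimes> g \<otimes> inv x) \<otimes> x = g"
      using g assms(3,4) by (auto simp: m_assoc simp flip: m_assoc[of "inv x" x])
    then show "g \<in> conj_set G x F" using conj_setI[OF assms(2)[OF g], of G x] by simp
  qed
qed

lemma conj_set_normal: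
  assumes "F \<lhd> G" "x \<in> carrier G"
  shows "conj_set G x F = F"
proof -
  interpret F: normal F G by fact
  show ?thesis using F.inv_op_closed1 F.inv_op_closed2 assms(2) F.subset
    by (intro conj_set_eq_self) auto
qed

text \<open>\<open>normalizer\<close> is a stabilizer under y B y^-1, while \<open>conj_set\<close>
  uses y^-1 B y; the passage goes through \<open>inv y\<close>.\<close>

lemma normalizer_conj_set:
  assumes "y \<in> normalizer G B" "B \<subseteq> carrier G"
  shows "y \<in> carrier G" "conj_set G y B = B"
proof -
  show y: "y \<in> carrier G" using assms by (auto simp: normalizer_def stabilizer_def)
  have "y <#\<^bsub>G\<^esub> B #>\<^bsub>G\<^esub> inv y = B" using assms by (auto simp: normalizer_def stabilizer_def)
  moreover have "conj_set G (inv y) B = y <#\<^bsub>G\<^esub> B #>\<^bsub>G\<^esub> inv y"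
    using y by (auto simp: conj_set_def l_coset_def r_coset_def)
  ultimately have "conj_set G y B = conj_set G y (conj_set G (inv y) B)" by simp
  then show "conj_set G y B = B" using assms(2) y by (simp add: conj_set_conj_set conj_set_one)
qed

end

section \<open>Regular independent families and lifts to the active sum\<close>

text \<open>An element g of both A and B can be placed in one summand and its inverse in the other.
  The product in the abelianization is trivial, so injectivity makes the coset of g trivial, that
  is, g lies in the derived subgroup. A and B must differ for there to be two summands.\<close>

lemma (in group) independent_Int_subset_derived:
  assumes indep: "independent_family G ({A} \<union> {conj_set G x B | x. x \<in> carrier G})"
    and A: "A \<lhd> G" and B: "subgroup B G" and AB: "A \<noteq> B"
  shows "A \<inter> B \<subseteq> derived G (carrier G)"
proof
  fix g assume g: "g \<in> A \<inter> B"
  define D where "D = derived G (carrier G)"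
  interpret A: normal A G by fact
  interpret B: subgroup B G by fact
  interpret D: normal D G unfolding D_def by (rule derived_self_is_normal)
  interpret GD: comm_group "G Mod D" unfolding D_def by (rule derived_quot_is_comm_group)
  let ?fam = "{A} \<union> {conj_set G x B | x. x \<in> carrier G}"
  obtain T where T': "T \<subseteq> ?fam \<and>
      (\<forall>F\<in>?fam. \<exists>!F'. F' \<in> T \<and> (\<exists>x\<in>carrier G. F = conj_set G x F')) \<and>
      (\<lambda>c. finprod (G Mod D) (\<lambda>F. D <#> c F) T)
         \<in> iso (sum_group T (\<lambda>F. subgroup_generated G F Mod (F \<inter> D))) (G Mod D)"
    using indep unfolding independent_family_def D_def[symmetric] ..
  note T = T'[THEN conjunct1] T'[THEN conjunct2, THEN conjunct1] T'[THEN conjunct2, THEN conjunct2]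
  have fam: "subgroup F G" if "F \<in> ?fam" for F
    using that A.subgroup_axioms subgroup_conj_set[OF B] by auto
  \<comment> \<open>A is normal, hence alone in its class, so it is its own representative.\<close>
  have AT: "A \<in> T"
  proof -
    have "\<exists>!F'. F' \<in> T \<and> (\<exists>x\<in>carrier G. A = conj_set G x F')"
      by (rule bspec[OF T(2)]) simp
    then obtain F x where F: "F \<in> T" "x \<in> carrier G" "A = conj_set G x F" by blast
    have "F \<subseteq> carrier G" using F(1) T(1) fam subgroup.subset by blast
    then have "conj_set G (inv x) A = F" using F by (simp add: conj_set_conj_set conj_set_one)
    then show ?thesis using conj_set_normal[OF A, of "inv x"] F by simp
  qed
  have "B = conj_set G \<one> B" by (simp add: conj_set_one B.subset)
  then have "B \<in> ?fam" by blast
  then have "\<exists>!F'. F' \<in> T \<and> (\<exists>x\<in>carrier G. B = conj_set G x F')" by (rule bspec[OF T(2)])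
  then obtain B' x where B': "B' \<in> T" "x \<in> carrier G" "B = conj_set G x B'" by blast
  have B'G: "subgroup B' G" using B'(1) T(1) fam by blast
  then interpret B': subgroup B' G .
  have B'c: "B' = conj_set G (inv x) B" using B' B'.subset by (simp add: conj_set_conj_set conj_set_one)
  have AB': "A \<noteq> B'" using conj_set_normal[OF A B'(2)] B'(3) AB by auto
  \<comment> \<open>Every member other than A is a conjugate of B, hence of B'; uniqueness of
    representatives leaves only B'.\<close>
  have T_eq: "T = {A, B'}"
  proof -
    have "F = B'" if F: "F \<in> T" "F \<noteq> A" for F
    proof -
      obtain y where y: "y \<in> carrier G" "F = conj_set G y B" using F T(1) by blast
      have "F = conj_set G (x \<otimes> y) B'" using y B' B'.subset by (simp add: conj_set_conj_set)
      moreover have "F = conj_set G \<one> F" using y B.subset by (simp add: conj_set_one conj_subset)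
      moreover have "\<exists>!F'. F' \<in> T \<and> (\<exists>x\<in>carrier G. F = conj_set G x F')"
        by (rule bspec[OF T(2)]) (use F(1) T(1) in blast)
      ultimately show "F = B'" using F(1) B'(1,2) y(1) by (metis m_closed one_closed)
    qed
    then show ?thesis using AT B'(1) by blast
  qed
  \<comment> \<open>The class of \<open>B\<close> is represented by \<open>B'\<close>, so \<open>g\<close> is replaced by its conjugate \<open>h\<close> in
    \<open>A \<inter> B'\<close>; the cosets of \<open>h\<close> and \<open>inv h\<close> in the two summands have product 1 in \<open>G/D\<close>.\<close>
  define h where "h = x \<otimes> g \<otimes> inv x"
  have gc: "g \<in> carrier G" using g by auto
  have hA: "h \<in> A" using g B'(2) A.inv_op_closed2 by (simp add: h_def)
  have hB': "h \<in> B'"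
    using conj_setI[of g B G "inv x"] g B'(2) by (simp add: h_def B'c[symmetric])
  have hc: "h \<in> carrier G" using hA by auto
  let ?Q = "\<lambda>F. subgroup_generated G F Mod (F \<inter> D)"
  have norm: "F \<inter> D \<lhd> subgroup_generated G F" if "subgroup F G" for F
  proof -
    interpret F: subgroup F G by fact
    interpret GF: group "subgroup_generated G F" by simp
    show ?thesis
    proof (rule GF.normal_invI)
      show "subgroup (F \<inter> D) (subgroup_generated G F)"
        using subgroups_Inter_pair that D.subgroup_axioms by (simp add: subgroup_of_subgroup_generated)
    next
      fix y z assume "y \<in> carrier (subgroup_generated G F)" "z \<in> F \<inter> D"
      then show "y \<otimes>\<^bsub>subgroup_generated G F\<^esub> z \<otimes>\<^bsub>subgroup_generated G F\<^esub> inv\<^bsub>subgroup_generated G F\<^esub> y \<in> F \<inter> D"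
        using D.inv_op_closed2 by simp
    qed
  qed
  have subT: "subgroup F G" if "F \<in> T" for F using that T(1) fam by blast
  have grpQ: "group (?Q F)" if "F \<in> T" for F
    using normal.factorgroup_is_group[OF norm[OF subT[OF that]]] .
  \<comment> \<open>Elements of \<open>sum_group\<close> are extensional, hence the restriction to
    T.\<close>
  define c where "c = (\<lambda>F\<in>T. if F = A then (A \<inter> D) #> h else (B' \<inter> D) #> inv h)"
  have coset: "(F \<inter> D) #> y \<in> carrier (?Q F)" if "subgroup F G" "y \<in> F" for F y
    using that subgroup.carrier_subgroup_generated_subgroup[OF that(1)]
    by (auto simp: FactGroup_def RCOSETS_def r_coset_def)
  have "c F \<in> carrier (?Q F)" if "F \<in> T" for F
    using that coset[OF A.subgroup_axioms hA] coset[OF B'G, of "inv h"] hB' by (auto simp: c_def T_eq)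
  moreover have "c \<in> extensional T" "finite T" by (simp_all add: c_def T_eq)
  ultimately have c: "c \<in> carrier (sum_group T ?Q)"
    by (simp add: carrier_sum_group[OF grpQ] PiE_iff)
  have one: "\<one>\<^bsub>sum_group T ?Q\<^esub> \<in> carrier (sum_group T ?Q)"
    by (rule monoid.one_closed[OF group.is_monoid[OF sum_group[OF grpQ]]])
  \<comment> \<open>D absorbs F \<inter> D, so the canonical map sends a coset of F \<inter> D to
    the coset of D containing it.\<close>
  have absorb: "D <#> (F \<inter> D) = D" if "subgroup F G" for F
  proof
    show "D <#> (F \<inter> D) \<subseteq> D" by (auto simp: set_mult_def)
    show "D \<subseteq> D <#> (F \<inter> D)"
      by (rule set_mult_subset_left[OF D.subset subgroups_Inter_pair[OF that D.subgroup_axioms]])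
  qed
  have DF: "D <#> ((F \<inter> D) #> y) = D #> y" if "subgroup F G" "y \<in> carrier G" for F y
    using setmult_rcos_assoc[of D "F \<inter> D" y] absorb[OF that(1)] that(2) D.subset by auto
  have inD: "D #> y \<in> carrier (G Mod D)" if "y \<in> carrier G" for y
    using that by (auto simp: FactGroup_def RCOSETS_def)
  have "finprod (G Mod D) (\<lambda>F. D <#> c F) T = (D #> h) \<otimes>\<^bsub>G Mod D\<^esub> (D #> inv h)"
    unfolding T_eq using AB' hc inD GD.r_one[OF inD[of "inv h"]]
    by (simp add: c_def T_eq DF A.subgroup_axioms B'G)
  also have "\<dots> = D" using hc by (simp add: FactGroup_def D.rcos_sum coset_join2 D.subgroup_axioms D.one_closed)
  finally have fc: "finprod (G Mod D) (\<lambda>F. D <#> c F) T = D" .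
  have f1: "finprod (G Mod D) (\<lambda>F. D <#> \<one>\<^bsub>sum_group T ?Q\<^esub> F) T = D"
  proof -
    have "D <#> (F \<inter> D) = D" if "F \<in> T" for F using absorb subT that by blast
    then have "finprod (G Mod D) (\<lambda>F. D <#> \<one>\<^bsub>sum_group T ?Q\<^esub> F) T = finprod (G Mod D) (\<lambda>F. \<one>\<^bsub>G Mod D\<^esub>) T"
      using GD.one_closed by (intro GD.finprod_cong') (auto simp: FactGroup_def)
    also have "\<dots> = D" by (metis GD.finprod_one one_FactGroup)
    finally show ?thesis .
  qed
  have inj: "inj_on (\<lambda>c. finprod (G Mod D) (\<lambda>F. D <#> c F) T) (carrier (sum_group T ?Q))"
    using T(3) unfolding iso_def bij_betw_def by blast
  have "c = \<one>\<^bsub>sum_group T ?Q\<^esub>"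
    by (rule inj_onD[OF inj HOL.trans[OF fc f1[symmetric]] c one])
  then have "c A = (A \<inter> D)" using AT by (simp add: FactGroup_def)
  then have "(A \<inter> D) #> h = A \<inter> D" using AT by (simp add: c_def)
  moreover have "h \<in> (A \<inter> D) #> h"
    by (rule rcos_self[OF hc subgroups_Inter_pair[OF A.subgroup_axioms D.subgroup_axioms]])
  ultimately have hD: "h \<in> D" by blast
  have "inv x \<otimes> h \<otimes> x = g"
    using gc B'(2) by (simp add: h_def m_assoc flip: m_assoc[of "inv x" x])
  then show "g \<in> derived G (carrier G)" using D.inv_op_closed1[OF B'(2) hD] by (simp add: D_def)
qed

text \<open>If d e and d' e' have the same image, so have d'^-1 d in D and e' e^-1 in E, and these
  are then equal. The hypothesis with e = 1 already contains injectivity on D, and symmetrically on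
  E.\<close>

lemma (in group_hom) inj_on_set_mult:
  assumes D: "subgroup D G" and E: "subgroup E G"
    and eq: "\<And>d e. d \<in> D \<Longrightarrow> e \<in> E \<Longrightarrow> h d = h e \<Longrightarrow> d = e"
  shows "inj_on h (D <#>\<^bsub>G\<^esub> E)"
proof (rule inj_onI)
  interpret D: subgroup D G by fact
  interpret E: subgroup E G by fact
  fix x y assume "x \<in> D <#>\<^bsub>G\<^esub> E" "y \<in> D <#>\<^bsub>G\<^esub> E" and xy: "h x = h y"
  then obtain d e d' e' where A: "d \<in> D" "e \<in> E" "x = d \<otimes>\<^bsub>G\<^esub> e" "d' \<in> D" "e' \<in> E" "y = d' \<otimes>\<^bsub>G\<^esub> e'"
    by (auto simp: set_mult_def)
  have "h (inv\<^bsub>G\<^esub> d') \<otimes>\<^bsub>H\<^esub> h x \<otimes>\<^bsub>H\<^esub> h (inv\<^bsub>G\<^esub> e) = h (inv\<^bsub>G\<^esub> d') \<otimes>\<^bsub>H\<^esub> h y \<otimes>\<^bsub>H\<^esub> h (inv\<^bsub>G\<^esub> e)"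
    using xy by simp
  moreover have "inv\<^bsub>G\<^esub> d' \<otimes>\<^bsub>G\<^esub> x \<otimes>\<^bsub>G\<^esub> inv\<^bsub>G\<^esub> e = inv\<^bsub>G\<^esub> d' \<otimes>\<^bsub>G\<^esub> d"
    using A by (simp add: G.m_assoc)
  moreover have "inv\<^bsub>G\<^esub> d' \<otimes>\<^bsub>G\<^esub> y \<otimes>\<^bsub>G\<^esub> inv\<^bsub>G\<^esub> e = e' \<otimes>\<^bsub>G\<^esub> inv\<^bsub>G\<^esub> e"
    using A by (simp flip: G.m_assoc)
  ultimately have "h (inv\<^bsub>G\<^esub> d' \<otimes>\<^bsub>G\<^esub> d) = h (e' \<otimes>\<^bsub>G\<^esub> inv\<^bsub>G\<^esub> e)"
    using A by (metis D.mem_carrier E.mem_carrier G.inv_closed G.m_closed hom_mult)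
  then have *: "inv\<^bsub>G\<^esub> d' \<otimes>\<^bsub>G\<^esub> d = e' \<otimes>\<^bsub>G\<^esub> inv\<^bsub>G\<^esub> e" using A by (intro eq) auto
  have "d' \<otimes>\<^bsub>G\<^esub> (inv\<^bsub>G\<^esub> d' \<otimes>\<^bsub>G\<^esub> d) \<otimes>\<^bsub>G\<^esub> e = d \<otimes>\<^bsub>G\<^esub> e" using A by (simp flip: G.m_assoc)
  moreover have "d' \<otimes>\<^bsub>G\<^esub> (e' \<otimes>\<^bsub>G\<^esub> inv\<^bsub>G\<^esub> e) \<otimes>\<^bsub>G\<^esub> e = d' \<otimes>\<^bsub>G\<^esub> e'" using A by (simp add: G.m_assoc)
  ultimately show "x = y" using * A by simp
qed

lemma (in group_hom) image_set_mult:
  assumes "D \<subseteq> carrier G" "E \<subseteq> carrier G"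
  shows "h ` (D <#>\<^bsub>G\<^esub> E) = h ` D <#>\<^bsub>H\<^esub> h ` E"
  using assms unfolding set_mult_def by (auto simp: subset_iff image_iff) metis+

context conj_closed_family
begin

lemma letters_conj_fixed:
  assumes "s \<in> carrier S" "F \<in> \<F>" "d \<in> letters G \<F> F" "conj_set G (\<phi> s) F = F"
  shows "inv\<^bsub>S\<^esub> s \<otimes>\<^bsub>S\<^esub> d \<otimes>\<^bsub>S\<^esub> s \<in> letters G \<F> F"
  using letters_conj[OF assms(1-3)] assms(4) by simp

lemma letters_carrier: "F \<in> \<F> \<Longrightarrow> d \<in> letters G \<F> F \<Longrightarrow> d \<in> carrier S"
  using letters_subgroup subgroup.mem_carrier by metis

lemma eval_letters_mem: "F \<in> \<F> \<Longrightarrow> d \<in> letters G \<F> F \<Longrightarrow> \<phi> d \<in> F"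
  using eval_letters by blast

text \<open>Let x be in B and let y = b a normalize B. Lifted to S, conjugation by b fixes the
  letter of x because B is abelian, so the lift of [x, y] equals (x^-1 a^-1 x) a with a and x read
  as letters. This lies in the copy of A, which letters of B normalize. An element of the copy of A
  and one of the copy of B that coincide in S have the same value g.\<close>

lemma letters_agree:
  assumes A: "A \<in> \<F>" and B: "B \<in> \<F>" and sub: "subgroup (B <#> A) G"
    and abel: "\<And>x y. x \<in> B \<Longrightarrow> y \<in> B \<Longrightarrow> x \<otimes> y = y \<otimes> x"
    and norm: "\<And>b. b \<in> B \<Longrightarrow> conj_set G b A = A"
    and g: "g \<in> A" "g \<in> comm_sg (subgroup_generated G (B <#> A)) B
        (normalizer (subgroup_generated G (B <#> A)) B)"
  shows "letter G \<F> A g = letter G \<F> B g"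
proof -
  let ?Q = "subgroup_generated G (B <#> A)"
  interpret Q: group ?Q by simp
  interpret A: subgroup A G by (rule member_subgroup[OF A])
  interpret B: subgroup B G by (rule member_subgroup[OF B])
  interpret LA: subgroup "letters G \<F> A" S by (rule letters_subgroup[OF A])
  interpret LB: subgroup "letters G \<F> B" S by (rule letters_subgroup[OF B])
  have cQ: "carrier ?Q = B <#> A" using subgroup.carrier_subgroup_generated_subgroup[OF sub] .
  have BQ: "B \<subseteq> carrier ?Q" unfolding cQ by (rule set_mult_subset_left[OF B.subset A.subgroup_axioms])
  have comm: "inv\<^bsub>?Q\<^esub> x \<otimes>\<^bsub>?Q\<^esub> inv\<^bsub>?Q\<^esub> y \<otimes>\<^bsub>?Q\<^esub> x \<otimes>\<^bsub>?Q\<^esub> y \<in> B \<and>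
      letter G \<F> B (inv\<^bsub>?Q\<^esub> x \<otimes>\<^bsub>?Q\<^esub> inv\<^bsub>?Q\<^esub> y \<otimes>\<^bsub>?Q\<^esub> x \<otimes>\<^bsub>?Q\<^esub> y) \<in> letters G \<F> A"
    if x: "x \<in> B" and y: "y \<in> normalizer ?Q B" for x y
  proof -
    have yQ: "y \<in> carrier ?Q" and "conj_set ?Q y B = B"
      using Q.normalizer_conj_set[OF y BQ] by auto
    then have yB: "conj_set G y B = B" by (simp add: conj_set_subgroup_generated)
    obtain b a where ba: "b \<in> B" "a \<in> A" "y = b \<otimes> a" using yQ cQ by (auto simp: set_mult_def)
    \<comment> \<open>A lift of y to S. The letter of B at y^-1 x y can be computed with any such
      lift; this one uses letters of A and B only.\<close>
    define s where "s = letter G \<F> B b \<otimes>\<^bsub>S\<^esub> letter G \<F> A a"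
    have la: "letter G \<F> A a \<in> letters G \<F> A" "letter G \<F> A a \<in> carrier S"
      and lb: "letter G \<F> B b \<in> carrier S" and lx: "letter G \<F> B x \<in> carrier S"
      using ba x A B by (auto simp: letters_def letter_closed)
    have s: "s \<in> carrier S" "\<phi> s = y" using la lb by (auto simp: s_def ba eval_letter A B)
    let ?z = "inv y \<otimes> x \<otimes> y"
    have z: "?z \<in> B" using conj_setI[OF x, of G y] yB by simp
    have yc: "y \<in> carrier G" using ba by auto
    have eq: "inv\<^bsub>?Q\<^esub> x \<otimes>\<^bsub>?Q\<^esub> inv\<^bsub>?Q\<^esub> y \<otimes>\<^bsub>?Q\<^esub> x \<otimes>\<^bsub>?Q\<^esub> y = inv x \<otimes> ?z"
      using x yQ yc BQ by (auto simp: subset_iff m_assoc)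
    have "letter G \<F> B ?z = inv\<^bsub>S\<^esub> s \<otimes>\<^bsub>S\<^esub> letter G \<F> B x \<otimes>\<^bsub>S\<^esub> s"
      using letter_conj[OF s(1) B x] s(2) yB by simp
    also have "\<dots> = inv\<^bsub>S\<^esub> letter G \<F> A a \<otimes>\<^bsub>S\<^esub>
        (inv\<^bsub>S\<^esub> letter G \<F> B b \<otimes>\<^bsub>S\<^esub> letter G \<F> B x \<otimes>\<^bsub>S\<^esub> letter G \<F> B b) \<otimes>\<^bsub>S\<^esub> letter G \<F> A a"
      unfolding s_def using la lb lx by (simp add: S.inv_mult_group S.m_assoc)
    also have "inv\<^bsub>S\<^esub> letter G \<F> B b \<otimes>\<^bsub>S\<^esub> letter G \<F> B x \<otimes>\<^bsub>S\<^esub> letter G \<F> B b = letter G \<F> B x"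
      using abel[OF x ba(1)] x ba B by (intro S.commute_conj lx lb) (simp flip: letter_mult)
    finally have "letter G \<F> B (inv x \<otimes> ?z) =
        (inv\<^bsub>S\<^esub> letter G \<F> B x \<otimes>\<^bsub>S\<^esub> inv\<^bsub>S\<^esub> letter G \<F> A a \<otimes>\<^bsub>S\<^esub> letter G \<F> B x) \<otimes>\<^bsub>S\<^esub> letter G \<F> A a"
      using x z B la lx by (simp add: letter_mult letter_inv S.m_assoc)
    moreover have "inv\<^bsub>S\<^esub> letter G \<F> B x \<otimes>\<^bsub>S\<^esub> inv\<^bsub>S\<^esub> letter G \<F> A a \<otimes>\<^bsub>S\<^esub> letter G \<F> B x \<in> letters G \<F> A"
      using norm[OF x] la by (intro letters_conj_fixed[OF lx A]) (simp_all add: eval_letter B x)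
    ultimately have "letter G \<F> B (inv x \<otimes> ?z) \<in> letters G \<F> A" using la by simp
    then show ?thesis using eq x z by simp
  qed
  \<comment> \<open>Membership in B belongs to the induction claim, since letters multiply only
    within one factor.\<close>
  have "g \<in> B \<and> letter G \<F> B g \<in> letters G \<F> A"
    using g(2) unfolding comm_sg_def
  proof (induction rule: generate.induct)
    case one
    then show ?case using B by (simp add: letter_one)
  next
    case (incl h)
    then show ?case using comm by blast
  next
    case (inv h)
    then have h: "h \<in> B" "letter G \<F> B h \<in> letters G \<F> A" using comm by blast+
    then have "inv\<^bsub>?Q\<^esub> h = inv h" using BQ by auto
    then show ?case using h B by (simp add: letter_inv)
  next
    case (eng h1 h2)
    then show ?case using B by (simp add: letter_mult)
  qed
  then obtain g' where g': "g \<in> B" "g' \<in> A" "letter G \<F> B g = letter G \<F> A g'"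
    by (auto simp: letters_def)
  then have "g = g'" using eval_letter A B by metis
  with g' show ?thesis by simp
qed

end

section \<open>Subgroups of S on which \<phi> is injective\<close>

context conj_closed_family
begin

lemma subgroup_set_mult_letters:
  assumes "A \<in> \<F>" "subgroup E S" "\<And>e. e \<in> E \<Longrightarrow> conj_set G (\<phi> e) A = A"
  shows "subgroup (letters G \<F> A <#>\<^bsub>S\<^esub> E) S"
  using assms letters_subgroup[OF assms(1)] subgroup.mem_carrier[OF assms(2)]
  by (intro S.subgroup_set_mult letters_conj_fixed) auto

lemma inj_on_set_mult_trivial:
  assumes D: "subgroup D S" "inj_on \<phi> D" and E: "subgroup E S" "inj_on \<phi> E"
    and triv: "\<phi> ` D \<inter> \<phi> ` E \<subseteq> {\<one>}"
  shows "inj_on \<phi> (D <#>\<^bsub>S\<^esub> E)"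
proof (rule \<phi>.inj_on_set_mult[OF D(1) E(1)])
  fix d e assume de: "d \<in> D" "e \<in> E" "\<phi> d = \<phi> e"
  then have "\<phi> d = \<one>" "\<phi> e = \<one>" using triv by (auto simp: subset_iff image_iff)
  then have "d = \<one>\<^bsub>S\<^esub>" "e = \<one>\<^bsub>S\<^esub>"
    using de D E inj_onD[OF D(2), of d "\<one>\<^bsub>S\<^esub>"] inj_onD[OF E(2), of e "\<one>\<^bsub>S\<^esub>"]
    by (auto simp: subgroup.one_closed)
  then show "d = e" by simp
qed

text \<open>A and B may intersect nontrivially, so injectivity rests on agreement of the letters
  over A \<inter> B.\<close>

lemma lift_metacyclic:
  assumes A: "A \<in> \<F>" and B: "B \<in> \<F>"
    and norm: "\<And>b. b \<in> B \<Longrightarrow> conj_set G b A = A"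
    and agree: "\<And>g. g \<in> A \<Longrightarrow> g \<in> B \<Longrightarrow> letter G \<F> A g = letter G \<F> B g"
  shows "subgroup (letters G \<F> A <#>\<^bsub>S\<^esub> letters G \<F> B) S"
    and "inj_on \<phi> (letters G \<F> A <#>\<^bsub>S\<^esub> letters G \<F> B)"
proof -
  show "subgroup (letters G \<F> A <#>\<^bsub>S\<^esub> letters G \<F> B) S"
    by (rule subgroup_set_mult_letters[OF A letters_subgroup[OF B]])
       (use norm eval_letters_mem[OF B] in auto)
  show "inj_on \<phi> (letters G \<F> A <#>\<^bsub>S\<^esub> letters G \<F> B)"
  proof (rule \<phi>.inj_on_set_mult[OF letters_subgroup[OF A] letters_subgroup[OF B]])
    fix d e assume "d \<in> letters G \<F> A" "e \<in> letters G \<F> B" "\<phi> d = \<phi> e"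
    then show "d = e" using A B agree by (auto simp: letters_def eval_letter)
  qed
qed

text \<open>The lifts of the B_p A_p are multiplied one prime at a time. Coprimality serves twice:
  it makes the new factor commute with what is already built, and it makes the images meet
  trivially.\<close>

lemma lift_nilpotent:
  fixes A B :: "nat \<Rightarrow> 'a set"
  assumes fin: "finite (carrier G)" and H: "subgroup H G"
    and nil: "nilpotent_group (subgroup_generated G H)"
    and AB: "\<And>p. Factorial_Ring.prime p \<Longrightarrow> p dvd card H \<Longrightarrow> A p \<in> \<F>"
      "\<And>p. Factorial_Ring.prime p \<Longrightarrow> p dvd card H \<Longrightarrow> B p \<in> \<F>"
    and sub: "\<And>p. Factorial_Ring.prime p \<Longrightarrow> p dvd card H \<Longrightarrow> subgroup (B p <#> A p) G"
      "\<And>p. Factorial_Ring.prime p \<Longrightarrow> p dvd card H \<Longrightarrow> B p <#> A p \<subseteq> H"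
    and card: "\<And>p. Factorial_Ring.prime p \<Longrightarrow> p dvd card H \<Longrightarrow> card (B p <#> A p) = p ^ Factorial_Ring.multiplicity p (card H)"
    and norm: "\<And>p b. Factorial_Ring.prime p \<Longrightarrow> p dvd card H \<Longrightarrow> b \<in> B p \<Longrightarrow> conj_set G b (A p) = A p"
    and agree: "\<And>p g. Factorial_Ring.prime p \<Longrightarrow> p dvd card H \<Longrightarrow> g \<in> A p \<Longrightarrow> g \<in> B p \<Longrightarrow>
      letter G \<F> (A p) g = letter G \<F> (B p) g"
  shows "\<exists>D. subgroup D S \<and> inj_on \<phi> D \<and> \<phi> ` D = H \<and>
    (\<forall>p. Factorial_Ring.prime p \<longrightarrow> p dvd card H \<longrightarrow> letters G \<F> (A p) \<subseteq> D \<and> letters G \<F> (B p) \<subseteq> D)"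
proof -
  interpret H: subgroup H G by fact
  interpret GH: group "subgroup_generated G H" by simp
  have finH: "finite H" using finite_subset[OF H.subset fin] .
  have cardH: "card H \<noteq> 0" using finH H.one_closed by (metis card_0_eq empty_iff)
  let ?P = "{p. Factorial_Ring.prime p \<and> p dvd card H}"
  have finP: "finite ?P" using cardH by (auto intro: finite_subset[OF _ finite_divisors_nat[of "card H"]])
  have subA: "A p \<subseteq> B p <#> A p" and subB: "B p \<subseteq> B p <#> A p" if p: "p \<in> ?P" for p
  proof -
    have "subgroup (A p) G" "subgroup (B p) G" using p AB by (auto intro: member_subgroup)
    then show "A p \<subseteq> B p <#> A p" "B p \<subseteq> B p <#> A p"
      by (simp_all add: set_mult_subset_left set_mult_subset_right subgroup.subset)
  qed
  \<comment> \<open>The last conjunct is the invariant that keeps the next prime coprime to the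
    order of the image built so far.\<close>
  have step: "\<exists>D. subgroup D S \<and> inj_on \<phi> D \<and> \<phi> ` D \<subseteq> H \<and>
      (\<forall>p\<in>P. letters G \<F> (A p) \<subseteq> D \<and> letters G \<F> (B p) \<subseteq> D) \<and>
      (\<forall>q. Factorial_Ring.prime q \<longrightarrow> q dvd card (\<phi> ` D) \<longrightarrow> q \<in> P)"
    if "finite P" "P \<subseteq> ?P" for P
    using that
  proof (induction P rule: finite_induct)
    case empty
    show ?case by (intro exI[of _ "{\<one>\<^bsub>S\<^esub>}"]) (auto simp: S.triv_subgroup)
  next
    case (insert p P)
    then obtain D where D: "subgroup D S" "inj_on \<phi> D" "\<phi> ` D \<subseteq> H"
        "\<forall>p\<in>P. letters G \<F> (A p) \<subseteq> D \<and> letters G \<F> (B p) \<subseteq> D"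
        "\<forall>q. Factorial_Ring.prime q \<longrightarrow> q dvd card (\<phi> ` D) \<longrightarrow> q \<in> P" by auto
    interpret D: subgroup D S by fact
    have p: "Factorial_Ring.prime p" "p dvd card H" using insert.prems by auto
    let ?M = "B p <#> A p"
    let ?LA = "letters G \<F> (A p)" and ?LB = "letters G \<F> (B p)"
    define E where "E = ?LA <#>\<^bsub>S\<^esub> ?LB"
    have E: "subgroup E S" "inj_on \<phi> E"
      unfolding E_def by (rule lift_metacyclic; use AB norm agree p in simp)+
    interpret E: subgroup E S by fact
    interpret M: subgroup ?M G by (rule sub(1)[OF p])
    have finM: "finite ?M" using finite_subset[OF M.subset fin] .
    have ELA: "?LA \<subseteq> E" and ELB: "?LB \<subseteq> E"
      unfolding E_def using AB p letters_subgroup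
      by (simp_all add: S.set_mult_subset_left S.set_mult_subset_right subgroup.subset)
    have EM: "\<phi> ` E \<subseteq> ?M"
    proof -
      have "\<phi> (a \<otimes>\<^bsub>S\<^esub> b) \<in> ?M" if "a \<in> ?LA" "b \<in> ?LB" for a b
      proof -
        have "\<phi> a \<in> ?M" "\<phi> b \<in> ?M"
          using that eval_letters_mem AB[OF p] subA[of p] subB[of p] insert.prems by blast+
        then show ?thesis using that AB[OF p] letters_carrier by simp
      qed
      then show ?thesis by (auto simp: E_def set_mult_def)
    qed
    have \<phi>D: "subgroup (\<phi> ` D) G" and \<phi>E: "subgroup (\<phi> ` E) G"
      using D E by (auto intro: \<phi>.subgroup_img_is_subgroup)
    have fins: "finite (\<phi> ` D)" "finite (\<phi> ` E)"
      using D(3) EM finH finM by (auto intro: finite_subset)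
    have "\<not> p dvd card (\<phi> ` D)" using D(5) p insert.hyps by auto
    then have cop: "coprime (card ?M) (card (\<phi> ` D))"
      using p by (simp add: card prime_imp_coprime)
    have cent: "g \<otimes> \<phi> d = \<phi> d \<otimes> g" if "d \<in> D" "g \<in> ?M" for d g
    proof -
      have "g \<otimes>\<^bsub>subgroup_generated G H\<^esub> \<phi> d = \<phi> d \<otimes>\<^bsub>subgroup_generated G H\<^esub> g"
      proof (rule GH.nilpotent_coprime_commute[OF nil _ _ _ _ cop])
        show "g [^]\<^bsub>subgroup_generated G H\<^esub> card ?M = \<one>\<^bsub>subgroup_generated G H\<^esub>"
          "\<phi> d [^]\<^bsub>subgroup_generated G H\<^esub> card (\<phi> ` D) = \<one>\<^bsub>subgroup_generated G H\<^esub>"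
          using that pow_card_subgroup[OF M.subgroup_axioms] pow_card_subgroup[OF \<phi>D] finM fins
          by (simp_all add: pow_subgroup_generated)
      qed (use that D(3) sub(2)[OF p] in auto)
      then show ?thesis by simp
    qed
    \<comment> \<open>An element of E is a product of one letter of A_p and one of B_p; \<phi> d
      centralizes both factors in G, so each letter commutes with d in S.\<close>
    have comm: "e \<otimes>\<^bsub>S\<^esub> d = d \<otimes>\<^bsub>S\<^esub> e" if "d \<in> D" "e \<in> E" for d e
    proof -
      obtain a b where ab: "a \<in> ?LA" "b \<in> ?LB" "e = a \<otimes>\<^bsub>S\<^esub> b"
        using \<open>e \<in> E\<close> by (auto simp: E_def set_mult_def)
      have c: "a \<in> carrier S" "b \<in> carrier S" "d \<in> carrier S"
        using ab ELA ELB that by auto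
      have "a \<otimes>\<^bsub>S\<^esub> d = d \<otimes>\<^bsub>S\<^esub> a"
        using ab c AB[OF p] cent[OF that(1)] subA[of p] insert.prems by (intro letters_commute) auto
      moreover have "b \<otimes>\<^bsub>S\<^esub> d = d \<otimes>\<^bsub>S\<^esub> b"
        using ab c AB[OF p] cent[OF that(1)] subB[of p] insert.prems by (intro letters_commute) auto
      ultimately show ?thesis using c ab(3) by (metis S.m_assoc)
    qed
    let ?D' = "E <#>\<^bsub>S\<^esub> D"
    have triv: "\<phi> ` E \<inter> \<phi> ` D = {\<one>}"
    proof -
      have "?M \<inter> \<phi> ` D = {\<one>}" using coprime_card_Int[OF M.subgroup_axioms \<phi>D finM fins(1) cop] .
      then show ?thesis using EM subgroup.one_closed[OF \<phi>E] subgroup.one_closed[OF \<phi>D] by blast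
    qed
    have im: "\<phi> ` ?D' = \<phi> ` E <#> \<phi> ` D"
      by (rule \<phi>.image_set_mult[OF E.subset D.subset])
    have EH: "\<phi> ` E \<subseteq> H" using EM sub(2)[OF p] by blast
    have subs: "E \<subseteq> ?D'" "D \<subseteq> ?D'"
      using S.set_mult_subset_left[OF E.subset D(1)] S.set_mult_subset_right[OF E(1) D.subset] by auto
    have lets: "letters G \<F> (A r) \<subseteq> ?D'" "letters G \<F> (B r) \<subseteq> ?D'" if "r \<in> insert p P" for r
      using that ELA ELB D(4) subs by (metis insertE order_trans)+
    have primes: "q \<in> insert p P" if q: "Factorial_Ring.prime q" "q dvd card (\<phi> ` ?D')" for q
    proof -
      have "q dvd card (\<phi> ` E) * card (\<phi> ` D)"
        using q card_set_mult_trivial_Int[OF \<phi>E \<phi>D triv] by (simp add: im)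
      then consider "q dvd card (\<phi> ` E)" | "q dvd card (\<phi> ` D)" using q(1) prime_dvd_mult_iff by blast
      then show ?thesis
      proof cases
        case 1
        then have "q dvd p ^ Factorial_Ring.multiplicity p (card H)"
          using card_subgroup_dvd[OF \<phi>E M.subgroup_axioms EM] by (metis card[OF p] dvd_trans)
        then show ?thesis using q(1) p(1) by (metis prime_dvd_power primes_dvd_imp_eq insertI1)
      next
        case 2
        then show ?thesis using D(5) q(1) by simp
      qed
    qed
    show ?case
    proof (intro exI[of _ ?D'] conjI ballI allI impI)
      show "subgroup ?D' S"
        by (intro S.subgroup_set_mult D E) (metis comm S.commute_conj E.mem_carrier D.mem_carrier)
      show "inj_on \<phi> ?D'"
        using triv by (intro inj_on_set_mult_trivial D E) auto
      show "\<phi> ` ?D' \<subseteq> H" using EH D(3) by (auto simp: im set_mult_def image_subset_iff)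
    qed (fact lets primes)+
  qed
  obtain D where D: "subgroup D S" "inj_on \<phi> D" "\<phi> ` D \<subseteq> H"
      "\<forall>p\<in>?P. letters G \<F> (A p) \<subseteq> D \<and> letters G \<F> (B p) \<subseteq> D"
    using step[OF finP order_refl] by auto
  have \<phi>D: "subgroup (\<phi> ` D) G" using D(1) by (rule \<phi>.subgroup_img_is_subgroup)
  interpret \<phi>D: subgroup "\<phi> ` D" G by fact
  \<comment> \<open>The image contains B_p A_p, whose order is the full p-part of |H|, for every p;
    so it has at least the order of H.\<close>
  have "card H dvd card (\<phi> ` D)"
  proof (rule multiplicity_le_imp_dvd[OF cardH])
    fix p :: nat assume p: "Factorial_Ring.prime p"
    show "Factorial_Ring.multiplicity p (card H) \<le> Factorial_Ring.multiplicity p (card (\<phi> ` D))"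
    proof (cases "p dvd card H")
      case True
      have "A p \<subseteq> \<phi> ` D" "B p \<subseteq> \<phi> ` D"
        using D(4) p True eval_letters[OF AB(1)[OF p True]] eval_letters[OF AB(2)[OF p True]] by blast+
      then have "B p <#> A p \<subseteq> \<phi> ` D" unfolding set_mult_def by (auto intro!: \<phi>D.m_closed)
      then have "p ^ Factorial_Ring.multiplicity p (card H) dvd card (\<phi> ` D)"
        using card_subgroup_dvd[OF sub(1)[OF p True] \<phi>D] card[OF p True] by simp
      moreover have "card (\<phi> ` D) \<noteq> 0"
        using finite_subset[OF D(3) finH] \<phi>D.one_closed by (metis card_0_eq empty_iff)
      ultimately show ?thesis using p by (intro multiplicity_geI) auto
    qed (simp add: not_dvd_imp_multiplicity_0)
  qed
  moreover have "card (\<phi> ` D) dvd card H" using card_subgroup_dvd[OF \<phi>D H D(3)] .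
  ultimately have "\<phi> ` D = H" using D(3) finH by (simp add: card_subset_eq dvd_antisym)
  then show ?thesis using D by blast
qed

text \<open>Since \<phi> maps D onto G, every conjugating element x is the value of some s in D.
  Conjugating a base letter by s stays in D and produces the required letter of the conjugate
  factor.\<close>

lemma lift_eq_carrier:
  assumes D: "subgroup D S" "\<phi> ` D = carrier G"
    and base: "\<And>F. F \<in> \<B> \<Longrightarrow> F \<in> \<F>" "\<And>F. F \<in> \<B> \<Longrightarrow> letters G \<F> F \<subseteq> D"
    and conj: "\<And>F. F \<in> \<F> \<Longrightarrow> \<exists>x\<in>carrier G. \<exists>F'\<in>\<B>. F = conj_set G x F'"
  shows "D = carrier S"
proof
  interpret D: subgroup D S by fact
  show "D \<subseteq> carrier S" by (rule D.subset)
  have letter_D: "letter G \<F> F g \<in> D" if F: "F \<in> \<F>" and g: "g \<in> F" for F g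
  proof -
    obtain x F' where x: "x \<in> carrier G" "F' \<in> \<B>" "F = conj_set G x F'" using conj[OF F] by blast
    have "x \<in> \<phi> ` D" using D(2) x(1) by simp
    then obtain s where s: "s \<in> D" "\<phi> s = x" by auto
    obtain g' where g': "g' \<in> F'" "g = inv x \<otimes> g' \<otimes> x" using g x(3) by (auto simp: conj_set_def)
    have "letter G \<F> F g = inv\<^bsub>S\<^esub> s \<otimes>\<^bsub>S\<^esub> letter G \<F> F' g' \<otimes>\<^bsub>S\<^esub> s"
      using letter_conj[of s F' g'] s g' x base by simp
    moreover have "letter G \<F> F' g' \<in> D" using base(2)[OF x(2)] g'(1) by (auto simp: letters_def)
    ultimately show ?thesis using s by simp
  qed
  show "carrier S \<subseteq> D"
  proof
    fix s assume "s \<in> carrier S"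
    then show "s \<in> D" by (induction rule: word_induct) (auto simp: letter_D)
  qed
qed

text \<open>With D equal to S, injectivity on D is the required statement about words. Generation
  follows from surjectivity, since elements of S are products of letters and a letter has its value
  in a member.\<close>

lemma is_active_sumI:
  assumes D: "subgroup D S" "inj_on \<phi> D" "\<phi> ` D = carrier G"
    and base: "\<And>F. F \<in> \<B> \<Longrightarrow> F \<in> \<F>" "\<And>F. F \<in> \<B> \<Longrightarrow> letters G \<F> F \<subseteq> D"
    and conj: "\<And>F. F \<in> \<F> \<Longrightarrow> \<exists>x\<in>carrier G. \<exists>F'\<in>\<B>. F = conj_set G x F'"
  shows "is_active_sum G \<F>"
  unfolding is_active_sum_def
proof (intro conjI ballI allI impI)
  have DS: "D = carrier S" using lift_eq_carrier[OF D(1,3) base conj] by blast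
  show "generate G (\<Union>\<F>) = carrier G"
  proof
    have sub: "\<Union>\<F> \<subseteq> carrier G" using member_subset by blast
    show "generate G (\<Union>\<F>) \<subseteq> carrier G" by (rule generate_incl[OF sub])
    have "\<phi> s \<in> generate G (\<Union>\<F>)" if "s \<in> carrier S" for s
      using that
    proof (induction rule: word_induct)
      case one
      then show ?case by (simp add: generate.one)
    next
      case (letter F g t)
      have "g \<in> generate G (\<Union>\<F>)" using letter by (intro generate.incl) blast
      then show ?case using letter by (simp add: letter_closed eval_letter generate.eng)
    qed
    then show "carrier G \<subseteq> generate G (\<Union>\<F>)" unfolding D(3)[symmetric] DS by auto
  qed
  fix w1 w2
  assume w: "valid_word \<F> w1" "valid_word \<F> w2" "word_eval G w1 = word_eval G w2"
  then have "asum_class G \<F> w1 = asum_class G \<F> w2"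
    using D(2) unfolding DS by (elim inj_onD) (simp_all add: carrier_active_sum asum_eval_class)
  then show "asum_rel G \<F> w1 w2" by (simp add: asum_class_eq_iff)
qed (auto simp: member_subgroup conj_member)

end

section \<open>Conjugates of U, and agreement of letters for A_p and B_p\<close>

lemma (in group) generate_singleton_commute:
  assumes "g \<in> carrier G" "x \<in> generate G {g}" "y \<in> generate G {g}"
  shows "x \<otimes> y = y \<otimes> x"
proof -
  obtain i j :: int where "x = g [^] i" "y = g [^] j"
    using assms by (auto simp: generate_pow)
  then show ?thesis using assms(1) by (simp add: add.commute flip: int_pow_mult)
qed

text \<open>Moving v^i past u turns it into v^(\<eta> i), and the remaining factor v^-i lowers the
  exponent to i(\<eta> - 1). This exhibits the generators of the F_i as conjugates of u.\<close>

lemma (in group) conj_power_of_conj_eq_power: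
  fixes i \<eta> :: int
  assumes "u \<in> carrier G" "v \<in> carrier G" "inv u \<otimes> v \<otimes> u = v [^] \<eta>"
  shows "inv (v [^] (- i)) \<otimes> u \<otimes> v [^] (- i) = u \<otimes> v [^] (i * (\<eta> - 1))"
proof -
  interpret h: group_hom G G "\<lambda>g. inv u \<otimes> g \<otimes> u"
    by unfold_locales (rule conj_hom[OF assms(1)])
  have "inv u \<otimes> v [^] i \<otimes> u = v [^] (\<eta> * i)"
    using h.hom_int_pow[of v i] assms by (simp add: int_pow_pow)
  then have "u \<otimes> (inv u \<otimes> v [^] i \<otimes> u) = u \<otimes> v [^] (\<eta> * i)" by simp
  then have "v [^] i \<otimes> u = u \<otimes> v [^] (\<eta> * i)" using assms by (simp flip: m_assoc)
  moreover have "inv (v [^] (- i)) = v [^] i" using assms by (simp add: int_pow_neg)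
  ultimately have "inv (v [^] (- i)) \<otimes> u \<otimes> v [^] (- i) = u \<otimes> (v [^] (\<eta> * i) \<otimes> v [^] (- i))"
    using assms by (simp add: m_assoc)
  also have "v [^] (\<eta> * i) \<otimes> v [^] (- i) = v [^] (i * (\<eta> - 1))"
    using assms by (simp add: algebra_simps flip: int_pow_mult)
  finally show ?thesis .
qed

text \<open>Independence puts g into the derived subgroup of BA, and regularity of the member B then
  writes it through commutators of B with its normalizer. The case A = B is separate because the
  independence argument needs two distinct summands.\<close>

lemma (in conj_closed_family) letters_agree_regular_independent:
  assumes A: "A \<in> \<F>" and B: "B \<in> \<F>" and sub: "subgroup (B <#> A) G"
    and abel: "\<And>x y. x \<in> B \<Longrightarrow> y \<in> B \<Longrightarrow> x \<otimes> y = y \<otimes> x"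
    and norm: "A \<lhd> subgroup_generated G (B <#> A)"
    and regular: "regular_family (subgroup_generated G (B <#> A))
      ({A} \<union> {conj_set G x B | x. x \<in> B <#> A})"
    and indep: "independent_family (subgroup_generated G (B <#> A))
      ({A} \<union> {conj_set G x B | x. x \<in> B <#> A})"
    and g: "g \<in> A" "g \<in> B"
  shows "letter G \<F> A g = letter G \<F> B g"
proof (cases "A = B")
  case False
  let ?M = "B <#> A"
  let ?Q = "subgroup_generated G ?M"
  interpret Q: group ?Q by simp
  have sA: "subgroup A G" and sB: "subgroup B G" using A B by (auto intro: member_subgroup)
  have cQ: "carrier ?Q = ?M" using subgroup.carrier_subgroup_generated_subgroup[OF sub] .
  have BM: "B \<subseteq> ?M" using sA sB by (simp add: set_mult_subset_left subgroup.subset)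
  have conj_Q: "conj_set ?Q x B = conj_set G x B" if "x \<in> ?M" for x
    using that by (simp add: conj_set_subgroup_generated cQ)
  have "{conj_set G x B | x. x \<in> ?M} = {conj_set ?Q x B | x. x \<in> carrier ?Q}"
    unfolding cQ using conj_Q by force
  with indep have "A \<inter> B \<subseteq> derived ?Q (carrier ?Q)"
    using False norm subgroup_of_subgroup_generated[OF BM sB]
    by (intro Q.independent_Int_subset_derived) simp_all
  moreover have "conj_set G \<one> B = B" using sB by (simp add: conj_set_one subgroup.subset)
  then have "B \<in> {conj_set G x B | x. x \<in> ?M}"
    using subgroup.one_closed[OF sub] by (metis (mono_tags, lifting) mem_Collect_eq)
  then have "comm_sg ?Q B (normalizer ?Q B) = B \<inter> derived ?Q (carrier ?Q)"
    using regular unfolding regular_family_def by blast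
  ultimately have "g \<in> comm_sg ?Q B (normalizer ?Q B)" using g by blast
  moreover have "conj_set G b A = A" if "b \<in> B" for b
    using Q.conj_set_normal[OF norm, of b] that BM by (simp add: cQ conj_set_subgroup_generated subset_iff)
  ultimately show ?thesis using letters_agree[OF A B sub abel] g by blast
qed simp

theorem theorem4p4:
  fixes G :: "('a, 'b) monoid_scheme"
    and a b u v :: 'a and K L N H U V :: "'a set"
    and \<zeta> \<epsilon> :: nat and \<eta> :: int
    and \<alpha> \<beta> :: "nat \<Rightarrow> 'a"
    and \<F>N \<F>H \<F> :: "'a set set"
  assumes grp: "group G" and fin: "finite (carrier G)"
    \<comment> \<open>metacyclic factorization G = LK\<close>
    and ab: "a \<in> carrier G" "b \<in> carrier G"
    and K: "K = generate G {a}" and L: "L = generate G {b}"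
    and K_normal: "K \<lhd> G" and LK: "L <#>\<^bsub>G\<^esub> K = carrier G"
    \<comment> \<open>standard Hall decomposition G = N \<rtimes> H\<close>
    and N_normal: "N \<lhd> G" and H_sub: "subgroup H G"
    and coprime_NH: "coprime (card N) (card H)"
    and NH: "N <#>\<^bsub>G\<^esub> H = carrier G" and N_int_H: "N \<inter> H = {\<one>\<^bsub>G\<^esub>}"
    and H_nilp: "nilpotent_group (subgroup_generated G H)"
    and uv: "u \<in> carrier G" "v \<in> carrier G"
    and U: "U = L \<inter> N" "U = generate G {u}"
    and V: "V = K \<inter> N" "V = generate G {v}"
    and V_normal: "V \<lhd> G"
    and N_split: "N = U <#>\<^bsub>G\<^esub> V" "U \<inter> V = {\<one>\<^bsub>G\<^esub>}"
    and U_cent_H: "\<forall>x\<in>U. \<forall>y\<in>H. x \<otimes>\<^bsub>G\<^esub> y = y \<otimes>\<^bsub>G\<^esub> x"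
    and derived_N: "derived G (carrier G) \<inter> N = V"
    \<comment> \<open>presentation of N\<close>
    and \<zeta>: "\<zeta> = group.ord G v" and \<epsilon>: "\<epsilon> = group.ord G u"
    and \<eta>: "inv\<^bsub>G\<^esub> u \<otimes>\<^bsub>G\<^esub> v \<otimes>\<^bsub>G\<^esub> u = v [^]\<^bsub>G\<^esub> \<eta>"
    \<comment> \<open>the family F_N\<close>
    and \<F>N: "\<F>N = {V} \<union>
        {generate G {u \<otimes>\<^bsub>G\<^esub> v [^]\<^bsub>G\<^esub> (int i * (\<eta> - 1))} | i. 1 \<le> i \<and> i \<le> \<zeta>}"
    \<comment> \<open>the Sylow subgroups H_p = B_p A_p and the families F_{H_p}\<close>
    and Hp: "\<And>p. Factorial_Ring.prime p \<Longrightarrow> p dvd card H \<Longrightarrow>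
        \<alpha> p \<in> carrier G \<and> \<beta> p \<in> carrier G \<and>
        subgroup (generate G {\<beta> p} <#>\<^bsub>G\<^esub> generate G {\<alpha> p}) G \<and>
        generate G {\<beta> p} <#>\<^bsub>G\<^esub> generate G {\<alpha> p} \<subseteq> H \<and>
        card (generate G {\<beta> p} <#>\<^bsub>G\<^esub> generate G {\<alpha> p})
          = p ^ Factorial_Ring.multiplicity p (card H) \<and>
        generate G {\<alpha> p} \<lhd> subgroup_generated G
            (generate G {\<beta> p} <#>\<^bsub>G\<^esub> generate G {\<alpha> p}) \<and>
        regular_family
          (subgroup_generated G (generate G {\<beta> p} <#>\<^bsub>G\<^esub> generate G {\<alpha> p}))
          ({generate G {\<alpha> p}} \<union>
           {conj_set G x (generate G {\<beta> p}) | x.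
              x \<in> generate G {\<beta> p} <#>\<^bsub>G\<^esub> generate G {\<alpha> p}}) \<and>
        independent_family
          (subgroup_generated G (generate G {\<beta> p} <#>\<^bsub>G\<^esub> generate G {\<alpha> p}))
          ({generate G {\<alpha> p}} \<union>
           {conj_set G x (generate G {\<beta> p}) | x.
              x \<in> generate G {\<beta> p} <#>\<^bsub>G\<^esub> generate G {\<alpha> p}})"
    and \<F>H: "\<F>H = (\<Union>p\<in>{p. Factorial_Ring.prime p \<and> p dvd card H}.
        {generate G {\<alpha> p}} \<union>
        {conj_set G x (generate G {\<beta> p}) | x.
           x \<in> generate G {\<beta> p} <#>\<^bsub>G\<^esub> generate G {\<alpha> p}})"
    \<comment> \<open>closure under conjugation in G\<close>
    and \<F>: "\<F> = {conj_set G x F | x F. x \<in> carrier G \<and> F \<in> \<F>N \<union> \<F>H}"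
  shows "is_active_sum G \<F>"
proof -
  interpret G: group G by (rule grp)
  define A where "A p = generate G {\<alpha> p}" for p
  define B where "B p = generate G {\<beta> p}" for p
  define P where "P = {p. Factorial_Ring.prime p \<and> p dvd card H}"
  define M where "M p = B p <#>\<^bsub>G\<^esub> A p" for p
  note Hp' = Hp[folded A_def B_def, folded M_def]
  have PD: "Factorial_Ring.prime p" "p dvd card H" if "p \<in> P" for p using that by (auto simp: P_def)
  \<comment> \<open>Representatives of the members up to conjugacy in G; only their letters have to
    be placed in the lifted subgroup.\<close>
  define \<B> where "\<B> = {U, V} \<union> A ` P \<union> B ` P"
  have \<B>_sub: "subgroup F G" if "F \<in> \<B>" for F
  proof -
    have "subgroup (A p) G" "subgroup (B p) G" if "p \<in> P" for p
      using Hp'[OF PD[OF that]] by (auto simp: A_def B_def intro: G.generate_is_subgroup)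
    moreover have "subgroup U G" "subgroup V G"
      using uv unfolding U(2) V(2) by (auto intro: G.generate_is_subgroup)
    ultimately show ?thesis using that by (auto simp: \<B>_def)
  qed
  have \<B>_c: "F \<subseteq> carrier G" if "F \<in> \<B>" for F using \<B>_sub[OF that] by (rule subgroup.subset)
  have base_mem: "F \<in> \<F>N \<union> \<F>H" if "F \<in> \<B>" for F
  proof -
    have "conj_set G \<one>\<^bsub>G\<^esub> (B p) = B p" "\<one>\<^bsub>G\<^esub> \<in> M p" if "p \<in> P" for p
      using Hp'[OF PD[OF that]] \<B>_c[of "B p"] that
      by (auto simp: G.conj_set_one \<B>_def subgroup.one_closed)
    then have "B p \<in> \<F>H" "A p \<in> \<F>H" if "p \<in> P" for p
      using that unfolding \<F>H[folded A_def B_def, folded M_def P_def]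
      by (auto intro!: bexI[of _ p] exI[of _ "\<one>\<^bsub>G\<^esub>"])
    \<comment> \<open>U is the member with index \<zeta>: the exponent is a multiple of the order of
      v. Finiteness of G gives 1 \<le> \<zeta>.\<close>
    moreover have "U \<in> \<F>N"
    proof -
      have "v [^]\<^bsub>G\<^esub> (int \<zeta> * (\<eta> - 1)) = \<one>\<^bsub>G\<^esub>"
        using uv by (simp add: \<zeta> G.int_pow_eq_id)
      then have "U = generate G {u \<otimes>\<^bsub>G\<^esub> v [^]\<^bsub>G\<^esub> (int \<zeta> * (\<eta> - 1))}" using uv U by simp
      moreover have "1 \<le> \<zeta>" unfolding \<zeta> using G.ord_ge_1[OF fin uv(2)] .
      ultimately show ?thesis unfolding \<F>N by blast
    qed
    moreover have "V \<in> \<F>N" by (simp add: \<F>N)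
    ultimately show ?thesis using that by (auto simp: \<B>_def)
  qed
  have mem_base: "\<exists>x\<in>carrier G. \<exists>F'\<in>\<B>. F = conj_set G x F'" if F: "F \<in> \<F>N \<union> \<F>H" for F
  proof -
    have triv: "\<exists>x\<in>carrier G. \<exists>F'\<in>\<B>. F = conj_set G x F'" if "F \<in> \<B>" for F
      using that \<B>_c G.conj_set_one by (intro bexI[of _ "\<one>\<^bsub>G\<^esub>"] bexI[of _ F]) auto
    consider "F = V" | i where "F = generate G {u \<otimes>\<^bsub>G\<^esub> v [^]\<^bsub>G\<^esub> (int i * (\<eta> - 1))}"
      | p where "p \<in> P" "F = A p" | p x where "p \<in> P" "x \<in> M p" "F = conj_set G x (B p)"
      using F unfolding \<F>N \<F>H[folded A_def B_def, folded M_def P_def] by blast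
    then show ?thesis
    proof cases
      case (2 i)
      have "F = conj_set G (v [^]\<^bsub>G\<^esub> (- int i)) U"
        unfolding U(2) 2 using uv G.conj_power_of_conj_eq_power[OF uv \<eta>, of "int i"]
        by (subst G.conj_set_generate) simp_all
      then show ?thesis using uv
        by (intro bexI[of _ "v [^]\<^bsub>G\<^esub> (- int i)"] bexI[of _ U]) (auto simp: \<B>_def)
    next
      case (4 p x)
      have "x \<in> carrier G" using 4 Hp'[OF PD[OF 4(1)]] by (auto dest: subgroup.mem_carrier)
      then show ?thesis using 4 by (intro bexI[of _ x] bexI[of _ "B p"]) (auto simp: \<B>_def)
    qed (use triv in \<open>auto simp: \<B>_def\<close>)
  qed
  \<comment> \<open>A conjugate of a conjugate is a conjugate, so closing the whole of F_N and F_H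
    gives the same family as closing the representatives.\<close>
  have \<F>_iff: "F \<in> \<F> \<longleftrightarrow> (\<exists>x\<in>carrier G. \<exists>F'\<in>\<B>. F = conj_set G x F')" for F
  proof
    assume "F \<in> \<F>"
    then obtain x F1 where x: "x \<in> carrier G" "F1 \<in> \<F>N \<union> \<F>H" "F = conj_set G x F1"
      unfolding \<F> by blast
    obtain y F2 where y: "y \<in> carrier G" "F2 \<in> \<B>" "F1 = conj_set G y F2" using mem_base[OF x(2)] by blast
    have "F = conj_set G (y \<otimes>\<^bsub>G\<^esub> x) F2" using x y \<B>_c[OF y(2)] by (simp add: G.conj_set_conj_set)
    then show "\<exists>x\<in>carrier G. \<exists>F'\<in>\<B>. F = conj_set G x F'" using x y by blast
  next
    assume "\<exists>x\<in>carrier G. \<exists>F'\<in>\<B>. F = conj_set G x F'"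
    then show "F \<in> \<F>" using base_mem unfolding \<F> by blast
  qed
  have base_\<F>: "F \<in> \<F>" if "F \<in> \<B>" for F
    unfolding \<F>_iff using that G.conj_set_one[OF \<B>_c[OF that]] by (intro bexI[of _ "\<one>\<^bsub>G\<^esub>"] bexI[of _ F]) auto
  interpret conj_closed_family G \<F>
  proof (rule conj_closed_family.intro[OF grp], rule conj_closed_family_axioms.intro)
    fix F assume "F \<in> \<F>"
    then obtain x F' where x: "x \<in> carrier G" "F' \<in> \<B>" "F = conj_set G x F'" unfolding \<F>_iff by blast
    show "subgroup F G" unfolding x(3) using x \<B>_sub by (simp add: G.subgroup_conj_set)
    fix y assume y: "y \<in> carrier G"
    have "conj_set G y F = conj_set G (x \<otimes>\<^bsub>G\<^esub> y) F'" using x y \<B>_c by (simp add: G.conj_set_conj_set)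
    then show "conj_set G y F \<in> \<F>" unfolding \<F>_iff using x y by blast
  qed
  have AB: "A p \<in> \<F>" "B p \<in> \<F>" if "p \<in> P" for p
    using that base_\<F> by (auto simp: \<B>_def)
  have U\<F>: "U \<in> \<F>" and V\<F>: "V \<in> \<F>" using base_\<F> by (auto simp: \<B>_def)
  have "\<exists>D. subgroup D S \<and> inj_on \<phi> D \<and> \<phi> ` D = H \<and>
    (\<forall>p. Factorial_Ring.prime p \<longrightarrow> p dvd card H \<longrightarrow> letters G \<F> (A p) \<subseteq> D \<and> letters G \<F> (B p) \<subseteq> D)"
  proof (rule lift_nilpotent[OF fin H_sub H_nilp])
    fix p :: nat assume p: "Factorial_Ring.prime p" "p dvd card H"
    then have pP: "p \<in> P" by (simp add: P_def)
    note h = Hp'[OF p]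
    show "A p \<in> \<F>" "B p \<in> \<F>" using AB[OF pP] .
    show sub: "subgroup (B p <#>\<^bsub>G\<^esub> A p) G" and "B p <#>\<^bsub>G\<^esub> A p \<subseteq> H"
      "card (B p <#>\<^bsub>G\<^esub> A p) = p ^ Factorial_Ring.multiplicity p (card H)"
      using h by (simp_all add: M_def)
    have norm: "A p \<lhd> subgroup_generated G (B p <#>\<^bsub>G\<^esub> A p)" using h by (simp add: M_def)
    interpret Q: group "subgroup_generated G (B p <#>\<^bsub>G\<^esub> A p)" by simp
    show "conj_set G b (A p) = A p" if "b \<in> B p" for b
    proof -
      have "B p \<subseteq> B p <#>\<^bsub>G\<^esub> A p"
        using AB[OF pP] by (simp add: G.set_mult_subset_left member_subgroup subgroup.subset)
      then have "b \<in> carrier (subgroup_generated G (B p <#>\<^bsub>G\<^esub> A p))"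
        using that subgroup.carrier_subgroup_generated_subgroup[OF sub] by auto
      then show ?thesis using Q.conj_set_normal[OF norm] by (simp add: G.conj_set_subgroup_generated)
    qed
    show "letter G \<F> (A p) g = letter G \<F> (B p) g" if "g \<in> A p" "g \<in> B p" for g
    proof (rule letters_agree_regular_independent[OF AB[OF pP] sub _ norm _ _ that])
      show "x \<otimes>\<^bsub>G\<^esub> y = y \<otimes>\<^bsub>G\<^esub> x" if "x \<in> B p" "y \<in> B p" for x y
        using G.generate_singleton_commute[of "\<beta> p"] h that by (simp add: B_def)
    qed (use h in \<open>simp_all add: M_def\<close>)
  qed
  then obtain D where D: "subgroup D S" "inj_on \<phi> D" "\<phi> ` D = H"
    "\<And>p. p \<in> P \<Longrightarrow> letters G \<F> (A p) \<subseteq> D \<and> letters G \<F> (B p) \<subseteq> D"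
    using PD by blast
  interpret D: subgroup D S by fact
  interpret N: normal N G by fact
  interpret U: subgroup U G by (rule member_subgroup[OF U\<F>])
  interpret V: subgroup V G by (rule member_subgroup[OF V\<F>])
  interpret H: subgroup H G by fact
  interpret LU: subgroup "letters G \<F> U" S by (rule letters_subgroup[OF U\<F>])
  interpret LV: subgroup "letters G \<F> V" S by (rule letters_subgroup[OF V\<F>])
  have UN: "U \<subseteq> N" and VN: "V \<subseteq> N" using U(1) V(1) by auto
  define E where "E = letters G \<F> U <#>\<^bsub>S\<^esub> D"
  have E: "subgroup E S"
    unfolding E_def
  proof (rule subgroup_set_mult_letters[OF U\<F> D(1)])
    fix d assume "d \<in> D"
    then have d: "\<phi> d \<in> H" "\<phi> d \<in> carrier G" using D(3) by auto
    have "inv\<^bsub>G\<^esub> (\<phi> d) \<otimes>\<^bsub>G\<^esub> x \<otimes>\<^bsub>G\<^esub> \<phi> d = x" if "x \<in> U" for x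
      using that d U_cent_H by (intro G.commute_conj) auto
    then show "conj_set G (\<phi> d) U = U" by (simp add: conj_set_def)
  qed
  interpret E: subgroup E S by fact
  have E_inj: "inj_on \<phi> E"
    unfolding E_def
    by (rule inj_on_set_mult_trivial[OF LU.subgroup_axioms letters_inj[OF U\<F>] D(1,2)])
       (use UN N_int_H in \<open>auto simp: eval_letters[OF U\<F>] D(3)\<close>)
  have E_im: "\<phi> ` E = U <#>\<^bsub>G\<^esub> H"
    unfolding E_def by (simp add: \<phi>.image_set_mult LU.subset D.subset eval_letters[OF U\<F>] D(3))
  define S0 where "S0 = letters G \<F> V <#>\<^bsub>S\<^esub> E"
  have S0: "subgroup S0 S"
    unfolding S0_def
    by (rule subgroup_set_mult_letters[OF V\<F> E]) (simp add: G.conj_set_normal[OF V_normal])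
  \<comment> \<open>If x = y z with x in V, y in U, z in H, then z = y^-1 x lies in N \<inter> H, so
    z = 1 and x lies in U \<inter> V.\<close>
  have "V \<inter> (U <#>\<^bsub>G\<^esub> H) \<subseteq> {\<one>\<^bsub>G\<^esub>}"
  proof
    fix x assume "x \<in> V \<inter> (U <#>\<^bsub>G\<^esub> H)"
    then obtain y z where x: "x \<in> V" "y \<in> U" "z \<in> H" "x = y \<otimes>\<^bsub>G\<^esub> z" by (auto simp: set_mult_def)
    then have "inv\<^bsub>G\<^esub> y \<otimes>\<^bsub>G\<^esub> x = z" by (simp flip: G.m_assoc)
    moreover have "inv\<^bsub>G\<^esub> y \<otimes>\<^bsub>G\<^esub> x \<in> N" using x UN VN by blast
    ultimately have "z = \<one>\<^bsub>G\<^esub>" using x(3) N_int_H by auto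
    then have "x \<in> U \<inter> V" using x by auto
    then show "x \<in> {\<one>\<^bsub>G\<^esub>}" using N_split(2) by simp
  qed
  then have S0_inj: "inj_on \<phi> S0"
    unfolding S0_def
    by (intro inj_on_set_mult_trivial LV.subgroup_axioms letters_inj V\<F> E E_inj)
       (simp add: eval_letters[OF V\<F>] E_im)
  have "\<phi> ` S0 = V <#>\<^bsub>G\<^esub> (U <#>\<^bsub>G\<^esub> H)"
    unfolding S0_def by (simp add: \<phi>.image_set_mult LV.subset E.subset eval_letters[OF V\<F>] E_im)
  \<comment> \<open>V is normal, so VU = UV = N, and NH is all of G.\<close>
  also have "\<dots> = (V <#>\<^bsub>G\<^esub> U) <#>\<^bsub>G\<^esub> H" by (simp add: G.set_mult_assoc V.subset U.subset H.subset)
  also have "\<dots> = carrier G"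
    using G.commut_normal[OF U.subgroup_axioms V_normal] N_split(1) NH by simp
  finally have S0_im: "\<phi> ` S0 = carrier G" .
  have DE: "D \<subseteq> E" "letters G \<F> U \<subseteq> E"
    unfolding E_def using S.set_mult_subset_right[OF LU.subgroup_axioms D.subset]
      S.set_mult_subset_left[OF LU.subset D(1)] by auto
  have ES: "E \<subseteq> S0" "letters G \<F> V \<subseteq> S0"
    unfolding S0_def using S.set_mult_subset_right[OF LV.subgroup_axioms E.subset]
      S.set_mult_subset_left[OF LV.subset E] by auto
  have base_letters: "letters G \<F> F \<subseteq> S0" if F: "F \<in> \<B>" for F
  proof -
    consider "F = U" | "F = V" | p where "p \<in> P" "F = A p \<or> F = B p"
      using F by (auto simp: \<B>_def)
    then show ?thesis
    proof cases
      case (3 p)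
      then have "letters G \<F> F \<subseteq> D" using D(4)[of p] by auto
      then show ?thesis using DE(1) ES(1) by simp
    qed (use DE ES in simp_all)
  qed
  show ?thesis
    using \<F>_iff by (intro is_active_sumI[OF S0 S0_inj S0_im base_\<F> base_letters]) auto
qed

end
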